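(* For all $r>\frac13$, the kernel $\ker i_{4,r}^*\subseteq H^*(\mathrm{Conf}_4)$ contains all of $H^2(\mathrm{Conf}_4)$ and the subspace of $H^1(\mathrm{Conf}_4)$ consisting of the classes for which the coefficients of the generators sum to zero.
   Context: $D^2$ is the closed unit disk in $\mathbb{R}^2$. $\mathrm{Conf}_n$ is the space of ordered $n$-tuples $(x_1,\ldots,x_n)$ of distinct points of $D^2$, and $\mathrm{Conf}_{n,r}\subseteq\mathrm{Conf}_n$ is the subspace of those tuples for which the open disks of radius $r$ centered at $x_1,\ldots,x_n$ are pairwise disjoint and contained in $D^2$. $i_{n,r}:\mathrm{Conf}_{n,r}\to\mathrm{Conf}_n$ is the inclusion, and $i_{n,r}^*$ is the induced map on integral singular cohomology. The generators of $H^1(\mathrm{Conf}_4)$ are the six classes (one for each pair $1\le i<j\le 4$) obtained by pulling back the generator $d\theta$ of $H^1(S^1)$ along the map $\mathrm{Conf}_4\to S^1$, $\vec{x}\mapsto\frac{x_j-x_i}{|x_j-x_i|}$; by a theorem of Arnol'd they form a free basis of $H^1(\mathrm{Conf}_4)$. *)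

theory Defs
  imports "HOL-Homology.Homology" "HOL-Analysis.Analysis"
begin

section \<open>Integral singular cohomology\<close>

text \<open>
  The singular chain groups are those of HOL-Homology.  As usual, the group of cochains is
  \<open>Hom(C\<^sub>p(X), \<int>)\<close>; cochains are made extensional so that equality of
  cochains is equality of functions.
\<close>

definition cochain_group :: "nat \<Rightarrow> 'a topology \<Rightarrow> ('a chain \<Rightarrow> int) monoid" where
  "cochain_group p X =
     \<lparr>carrier = hom (chain_group p X) integer_group \<inter> extensional (singular_chain_set p X),
      monoid.mult = (\<lambda>\<phi> \<psi>. \<lambda>c\<in>singular_chain_set p X. \<phi> c + \<psi> c),
      one = (\<lambda>c\<in>singular_chain_set p X. 0)\<rparr>"

definition coboundary :: "nat \<Rightarrow> 'a topology \<Rightarrow> ('a chain \<Rightarrow> int) \<Rightarrow> 'a chain \<Rightarrow> int" where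
  "coboundary p X \<phi> = (\<lambda>c\<in>singular_chain_set (Suc p) X. \<phi> (chain_boundary (Suc p) c))"

definition cocycle_group :: "nat \<Rightarrow> 'a topology \<Rightarrow> ('a chain \<Rightarrow> int) monoid" where
  "cocycle_group p X =
     subgroup_generated (cochain_group p X)
       (kernel (cochain_group p X) (cochain_group (Suc p) X) (coboundary p X))"

fun coboundary_set :: "nat \<Rightarrow> 'a topology \<Rightarrow> ('a chain \<Rightarrow> int) set" where
  "coboundary_set 0 X = {\<one>\<^bsub>cochain_group 0 X\<^esub>}"
| "coboundary_set (Suc p) X = coboundary p X ` carrier (cochain_group p X)"

definition cohomology_group :: "nat \<Rightarrow> 'a topology \<Rightarrow> ('a chain \<Rightarrow> int) set monoid" where
  "cohomology_group p X = cocycle_group p X Mod coboundary_set p X"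

definition cochain_map ::
    "nat \<Rightarrow> 'a topology \<Rightarrow> ('a \<Rightarrow> 'b) \<Rightarrow> ('b chain \<Rightarrow> int) \<Rightarrow> 'a chain \<Rightarrow> int" where
  "cochain_map p X f \<phi> = (\<lambda>c\<in>singular_chain_set p X. \<phi> (chain_map p f c))"

text \<open>
  The map \<open>f\<^sup>*\<close> from the cohomology of \<open>Y\<close> to that of \<open>X\<close>, for \<open>f\<close> from \<open>X\<close> to \<open>Y\<close>.
  All representatives \<open>\<phi>\<close> of the class \<open>A\<close> yield the same coset, so the union is that coset; see
  \<open>cohomology_map_class\<close> below.
\<close>

definition cohomology_map ::
    "nat \<Rightarrow> 'a topology \<Rightarrow> ('a \<Rightarrow> 'b) \<Rightarrow> ('b chain \<Rightarrow> int) set \<Rightarrow> ('a chain \<Rightarrow> int) set" where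
  "cohomology_map p X f A =
     (\<Union>\<phi>\<in>A. coboundary_set p X #>\<^bsub>cocycle_group p X\<^esub> cochain_map p X f \<phi>)"

definition total_cohomology :: "'a topology \<Rightarrow> (nat \<Rightarrow> ('a chain \<Rightarrow> int) set) monoid" where
  "total_cohomology X = sum_group UNIV (\<lambda>p. cohomology_group p X)"

definition in_degree ::
    "nat \<Rightarrow> 'a topology \<Rightarrow> ('a chain \<Rightarrow> int) set \<Rightarrow> nat \<Rightarrow> ('a chain \<Rightarrow> int) set" where
  "in_degree p X a = (\<lambda>q. if q = p then a else \<one>\<^bsub>cohomology_group q X\<^esub>)"

definition total_cohomology_map ::
    "'a topology \<Rightarrow> ('a \<Rightarrow> 'b) \<Rightarrow> (nat \<Rightarrow> ('b chain \<Rightarrow> int) set) \<Rightarrow> nat \<Rightarrow> ('a chain \<Rightarrow> int) set" where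
  "total_cohomology_map X f a = (\<lambda>p. cohomology_map p X f (a p))"

subsection \<open>Well-definedness\<close>

lemma carrier_cochain_group:
  "\<phi> \<in> carrier (cochain_group p X) \<longleftrightarrow>
     (\<forall>c d. singular_chain p X c \<longrightarrow> singular_chain p X d \<longrightarrow> \<phi> (c + d) = \<phi> c + \<phi> d)
     \<and> \<phi> \<in> extensional (singular_chain_set p X)"
  by (auto simp: cochain_group_def hom_def)

lemma mult_cochain_group [simp]:
  "\<phi> \<otimes>\<^bsub>cochain_group p X\<^esub> \<psi> = (\<lambda>c\<in>singular_chain_set p X. \<phi> c + \<psi> c)"
  by (simp add: cochain_group_def)

lemma one_cochain_group [simp]:
  "\<one>\<^bsub>cochain_group p X\<^esub> = (\<lambda>c\<in>singular_chain_set p X. 0)"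
  by (simp add: cochain_group_def)

lemma comm_group_cochain_group: "comm_group (cochain_group p X)"
proof (rule comm_groupI)
  fix \<phi> assume \<phi>: "\<phi> \<in> carrier (cochain_group p X)"
  show "\<exists>\<psi>\<in>carrier (cochain_group p X). \<psi> \<otimes>\<^bsub>cochain_group p X\<^esub> \<phi> = \<one>\<^bsub>cochain_group p X\<^esub>"
    using \<phi>
    by (intro bexI [where x = "\<lambda>c\<in>singular_chain_set p X. - \<phi> c"])
       (auto simp: carrier_cochain_group singular_chain_add)
  show "\<one>\<^bsub>cochain_group p X\<^esub> \<otimes>\<^bsub>cochain_group p X\<^esub> \<phi> = \<phi>"
    using \<phi> by (auto simp: carrier_cochain_group extensional_def restrict_def)
qed (auto simp: carrier_cochain_group singular_chain_add)

lemma coboundary_hom: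
  "coboundary p X \<in> hom (cochain_group p X) (cochain_group (Suc p) X)"
  by (auto simp: hom_def carrier_cochain_group coboundary_def chain_boundary_add
      singular_chain_add singular_chain_boundary_alt)

lemma group_hom_coboundary:
  "group_hom (cochain_group p X) (cochain_group (Suc p) X) (coboundary p X)"
  by (simp add: group_hom_def group_hom_axioms_def coboundary_hom
      comm_group.axioms(2) comm_group_cochain_group)

lemma comm_group_cocycle_group: "comm_group (cocycle_group p X)"
  unfolding cocycle_group_def
  by (simp add: group.abelian_subgroup_generated comm_group.axioms(2) comm_group_cochain_group)

lemma carrier_cocycle_group:
  "carrier (cocycle_group p X) =
     kernel (cochain_group p X) (cochain_group (Suc p) X) (coboundary p X)"
  unfolding cocycle_group_def
  by (rule subgroup.carrier_subgroup_generated_subgroup)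
     (rule group_hom.subgroup_kernel [OF group_hom_coboundary])

lemma mult_cocycle_group [simp]:
  "\<phi> \<otimes>\<^bsub>cocycle_group p X\<^esub> \<psi> = (\<lambda>c\<in>singular_chain_set p X. \<phi> c + \<psi> c)"
  by (simp add: cocycle_group_def)

lemma cocycle_iff:
  "\<phi> \<in> carrier (cocycle_group p X) \<longleftrightarrow>
     \<phi> \<in> carrier (cochain_group p X) \<and>
     (\<forall>c. singular_chain (Suc p) X c \<longrightarrow> \<phi> (chain_boundary (Suc p) c) = 0)"
  by (force simp: carrier_cocycle_group kernel_def coboundary_def restrict_def fun_eq_iff)

lemma cochain_zero:
  assumes "\<phi> \<in> carrier (cochain_group p X)" shows "\<phi> 0 = 0"
proof -
  have "\<phi> (0 + 0) = \<phi> 0 + \<phi> 0"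
    using assms singular_chain_0 unfolding carrier_cochain_group by blast
  then show ?thesis by simp
qed

lemma subgroup_coboundary_set: "subgroup (coboundary_set p X) (cocycle_group p X)"
proof -
  interpret C: comm_group "cochain_group p X" by (rule comm_group_cochain_group)
  have Z: "subgroup (carrier (cocycle_group p X)) (cochain_group p X)"
    unfolding carrier_cocycle_group by (rule group_hom.subgroup_kernel [OF group_hom_coboundary])
  have B: "subgroup (coboundary_set p X) (cochain_group p X)"
  proof (cases p)
    case 0
    then show ?thesis using C.triv_subgroup by simp
  next
    case (Suc q)
    then show ?thesis
      using group_hom.img_is_subgroup [OF group_hom_coboundary [of q X]] by simp
  qed
  have sub: "coboundary_set p X \<subseteq> carrier (cocycle_group p X)"
  proof (cases p)
    case 0
    then show ?thesis using subgroup.one_closed [OF Z] by simp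
  next
    case (Suc q)
    have "coboundary q X \<phi> \<in> carrier (cocycle_group (Suc q) X)"
      if "\<phi> \<in> carrier (cochain_group q X)" for \<phi>
      using that hom_in_carrier [OF coboundary_hom that] cochain_zero [OF that]
      by (auto simp: cocycle_iff coboundary_def singular_chain_boundary_alt
          chain_boundary_boundary_alt)
    then show ?thesis using Suc by auto
  qed
  show ?thesis
    unfolding cocycle_group_def
    using B sub C.subgroup_of_subgroup_generated
    by (simp add: carrier_cocycle_group)
qed

lemma normal_coboundary_set: "coboundary_set p X \<lhd> cocycle_group p X"
  by (simp add: comm_group.subgroup_imp_normal comm_group_cocycle_group subgroup_coboundary_set)

lemma comm_group_cohomology_group: "comm_group (cohomology_group p X)"
  unfolding cohomology_group_def
  by (simp add: comm_group.abelian_FactGroup comm_group_cocycle_group subgroup_coboundary_set)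

lemma cochain_map_cochain:
  assumes "continuous_map X Y f" "\<phi> \<in> carrier (cochain_group p Y)"
  shows "cochain_map p X f \<phi> \<in> carrier (cochain_group p X)"
  using assms
  by (auto simp: carrier_cochain_group cochain_map_def singular_chain_add chain_map_add
      singular_chain_chain_map)

lemma cochain_map_coboundary:
  assumes "continuous_map X Y f"
  shows "cochain_map (Suc p) X f (coboundary p Y \<phi>) = coboundary p X (cochain_map p X f \<phi>)"
proof
  fix c
  show "cochain_map (Suc p) X f (coboundary p Y \<phi>) c = coboundary p X (cochain_map p X f \<phi>) c"
    using assms singular_chain_chain_map [of "Suc p" X c Y f] chain_boundary_chain_map [of "Suc p" X c f]
      singular_chain_boundary_alt [of p X c]
    by (auto simp: cochain_map_def coboundary_def)
qed

lemma cochain_map_cocycle_hom: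
  assumes "continuous_map X Y f"
  shows "cochain_map p X f \<in> hom (cocycle_group p Y) (cocycle_group p X)"
proof -
  have "cochain_map p X f \<phi> \<in> carrier (cocycle_group p X)"
    if "\<phi> \<in> carrier (cocycle_group p Y)" for \<phi>
  proof -
    have "cochain_map p X f \<phi> (chain_boundary (Suc p) c) = 0" if c: "singular_chain (Suc p) X c" for c
    proof -
      have "\<phi> (chain_boundary (Suc p) (chain_map (Suc p) f c)) = 0"
        using \<open>\<phi> \<in> carrier (cocycle_group p Y)\<close> singular_chain_chain_map [OF c assms]
        by (simp add: cocycle_iff)
      then show ?thesis
        using chain_boundary_chain_map [OF c, of f] singular_chain_boundary_alt [OF c]
        by (simp add: cochain_map_def)
    qed
    then show ?thesis
      using that cochain_map_cochain [OF assms] by (simp add: cocycle_iff)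
  qed
  then show ?thesis
    using assms by (auto simp: hom_def cochain_map_def singular_chain_chain_map fun_eq_iff)
qed

lemma cochain_map_coboundary_set:
  assumes "continuous_map X Y f" "\<phi> \<in> coboundary_set p Y"
  shows "cochain_map p X f \<phi> \<in> coboundary_set p X"
proof (cases p)
  case 0
  then show ?thesis
    using assms by (auto simp: cochain_map_def singular_chain_chain_map fun_eq_iff)
next
  case (Suc q)
  then show ?thesis
    using assms by (auto simp: cochain_map_coboundary cochain_map_cochain)
qed

lemma cohomology_map_class:
  assumes f: "continuous_map X Y f" and \<phi>: "\<phi> \<in> carrier (cocycle_group p Y)"
  shows "cohomology_map p X f (coboundary_set p Y #>\<^bsub>cocycle_group p Y\<^esub> \<phi>) =
         coboundary_set p X #>\<^bsub>cocycle_group p X\<^esub> cochain_map p X f \<phi>"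
proof -
  interpret X: comm_group "cocycle_group p X" by (rule comm_group_cocycle_group)
  interpret Y: comm_group "cocycle_group p Y" by (rule comm_group_cocycle_group)
  note BX = subgroup_coboundary_set [of p X] and BY = subgroup_coboundary_set [of p Y]
  have f\<phi>: "cochain_map p X f \<phi> \<in> carrier (cocycle_group p X)"
    by (rule hom_in_carrier [OF cochain_map_cocycle_hom [OF f] \<phi>])
  have eq: "coboundary_set p X #>\<^bsub>cocycle_group p X\<^esub> cochain_map p X f \<psi> =
        coboundary_set p X #>\<^bsub>cocycle_group p X\<^esub> cochain_map p X f \<phi>"
    if \<psi>_in: "\<psi> \<in> coboundary_set p Y #>\<^bsub>cocycle_group p Y\<^esub> \<phi>" for \<psi>
  proof -
    obtain \<beta> where \<beta>: "\<beta> \<in> coboundary_set p Y" and \<psi>: "\<psi> = \<beta> \<otimes>\<^bsub>cocycle_group p Y\<^esub> \<phi>"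
      using \<psi>_in unfolding r_coset_def by blast
    have "cochain_map p X f \<psi> =
        cochain_map p X f \<beta> \<otimes>\<^bsub>cocycle_group p X\<^esub> cochain_map p X f \<phi>"
      unfolding \<psi>
      by (rule hom_mult [OF cochain_map_cocycle_hom [OF f] subgroup.mem_carrier [OF BY \<beta>] \<phi>])
    then have "cochain_map p X f \<psi> \<in> coboundary_set p X #>\<^bsub>cocycle_group p X\<^esub> cochain_map p X f \<phi>"
      unfolding r_coset_def using cochain_map_coboundary_set [OF f \<beta>] by blast
    then show ?thesis using X.repr_independence [OF _ f\<phi> BX] by metis
  qed
  moreover have "\<phi> \<in> coboundary_set p Y #>\<^bsub>cocycle_group p Y\<^esub> \<phi>"
    by (rule Y.rcos_self [OF \<phi> BY])
  ultimately show ?thesis unfolding cohomology_map_def by blast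
qed

lemma cohomology_map_hom:
  assumes f: "continuous_map X Y f"
  shows "cohomology_map p X f \<in> hom (cohomology_group p Y) (cohomology_group p X)"
proof (rule homI)
  interpret X: comm_group "cocycle_group p X" by (rule comm_group_cocycle_group)
  interpret Y: comm_group "cocycle_group p Y" by (rule comm_group_cocycle_group)
  note h = cochain_map_cocycle_hom [OF f, of p]
  fix A assume "A \<in> carrier (cohomology_group p Y)"
  then obtain \<phi> where \<phi>: "\<phi> \<in> carrier (cocycle_group p Y)"
      and A: "A = coboundary_set p Y #>\<^bsub>cocycle_group p Y\<^esub> \<phi>"
    by (auto simp: cohomology_group_def carrier_FactGroup)
  show "cohomology_map p X f A \<in> carrier (cohomology_group p X)"
    unfolding A cohomology_map_class [OF f \<phi>]
    using hom_in_carrier [OF h \<phi>] by (auto simp: cohomology_group_def carrier_FactGroup)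
  fix B assume "B \<in> carrier (cohomology_group p Y)"
  then obtain \<psi> where \<psi>: "\<psi> \<in> carrier (cocycle_group p Y)"
      and B: "B = coboundary_set p Y #>\<^bsub>cocycle_group p Y\<^esub> \<psi>"
    by (auto simp: cohomology_group_def carrier_FactGroup)
  have AB: "A \<otimes>\<^bsub>cohomology_group p Y\<^esub> B =
      coboundary_set p Y #>\<^bsub>cocycle_group p Y\<^esub> (\<phi> \<otimes>\<^bsub>cocycle_group p Y\<^esub> \<psi>)"
    unfolding A B cohomology_group_def mult_FactGroup
    by (rule normal.rcos_sum [OF normal_coboundary_set \<phi> \<psi>])
  show "cohomology_map p X f (A \<otimes>\<^bsub>cohomology_group p Y\<^esub> B) =
      cohomology_map p X f A \<otimes>\<^bsub>cohomology_group p X\<^esub> cohomology_map p X f B"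
    unfolding AB cohomology_map_class [OF f Y.m_closed [OF \<phi> \<psi>]] hom_mult [OF h \<phi> \<psi>]
    unfolding A B cohomology_map_class [OF f \<phi>] cohomology_map_class [OF f \<psi>]
      cohomology_group_def mult_FactGroup
    by (rule normal.rcos_sum [OF normal_coboundary_set, symmetric])
       (auto intro: hom_in_carrier [OF h] \<phi> \<psi>)
qed

lemma in_degree_closed:
  assumes "a \<in> carrier (cohomology_group p X)"
  shows "in_degree p X a \<in> carrier (total_cohomology X)"
proof -
  have G: "group (cohomology_group q X)" for q
    by (simp add: comm_group.axioms(2) comm_group_cohomology_group)
  have "finite {q. in_degree p X a q \<noteq> \<one>\<^bsub>cohomology_group q X\<^esub>}"
    by (rule finite_subset [of _ "{p}"]) (auto simp: in_degree_def)
  then show ?thesis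
    using assms group.is_monoid [OF G]
    by (auto simp: total_cohomology_def carrier_sum_group [OF G] in_degree_def
        monoid.one_closed)
qed

lemma total_cohomology_map_in_degree:
  assumes "continuous_map X Y f"
  shows "total_cohomology_map X f (in_degree p Y a) = in_degree p X (cohomology_map p X f a)"
proof -
  have "cohomology_map q X f \<one>\<^bsub>cohomology_group q Y\<^esub> = \<one>\<^bsub>cohomology_group q X\<^esub>" for q
    by (rule hom_one [OF cohomology_map_hom [OF assms]])
       (simp_all add: comm_group.axioms(2) comm_group_cohomology_group)
  then show ?thesis
    unfolding total_cohomology_map_def in_degree_def by (intro ext) simp
qed

section \<open>Configuration spaces of the closed disk\<close>

text \<open>An \<open>n\<close>-tuple is an extensional function on \<open>{1..n}\<close>.\<close>

definition Conf :: "nat \<Rightarrow> (nat \<Rightarrow> real ^ 2) topology" where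
  "Conf n = subtopology (product_topology (\<lambda>_. euclidean) {1..n})
     {x. (\<forall>i\<in>{1..n}. x i \<in> cball 0 1) \<and> inj_on x {1..n}}"

definition disk_Conf :: "nat \<Rightarrow> real \<Rightarrow> (nat \<Rightarrow> real ^ 2) topology" where
  "disk_Conf n r = subtopology (Conf n)
     {x. disjoint_family_on (\<lambda>i. ball (x i) r) {1..n} \<and> (\<forall>i\<in>{1..n}. ball (x i) r \<subseteq> cball 0 1)}"

definition circle :: "(real ^ 2) topology" where
  "circle = top_of_set (sphere 0 1)"

definition direction :: "nat \<Rightarrow> nat \<Rightarrow> (nat \<Rightarrow> real ^ 2) \<Rightarrow> real ^ 2" where
  "direction i j x = (x j - x i) /\<^sub>R norm (x j - x i)"

definition index_pairs :: "nat \<Rightarrow> (nat \<times> nat) set" where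
  "index_pairs n = {(i, j). 1 \<le> i \<and> i < j \<and> j \<le> n}"

definition conf_generator ::
    "nat \<Rightarrow> ((real ^ 2) chain \<Rightarrow> int) set \<Rightarrow> nat \<times> nat \<Rightarrow> ((nat \<Rightarrow> real ^ 2) chain \<Rightarrow> int) set" where
  "conf_generator n d\<theta> = (\<lambda>(i, j). cohomology_map 1 (Conf n) (direction i j) d\<theta>)"

text \<open>
  HOL-Algebra writes groups multiplicatively, so the product of powers below is the integer linear
  combination of the generators with coefficients \<open>c\<close>.
\<close>

definition conf_combination ::
    "nat \<Rightarrow> ((real ^ 2) chain \<Rightarrow> int) set \<Rightarrow> (nat \<times> nat \<Rightarrow> int) \<Rightarrow> ((nat \<Rightarrow> real ^ 2) chain \<Rightarrow> int) set" where
  "conf_combination n d\<theta> c =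
     finprod (cohomology_group 1 (Conf n))
       (\<lambda>p. conf_generator n d\<theta> p [^]\<^bsub>cohomology_group 1 (Conf n)\<^esub> c p) (index_pairs n)"

definition zero_sum_classes ::
    "nat \<Rightarrow> ((real ^ 2) chain \<Rightarrow> int) set \<Rightarrow> ((nat \<Rightarrow> real ^ 2) chain \<Rightarrow> int) set set" where
  "zero_sum_classes n d\<theta> = {conf_combination n d\<theta> c | c. (\<Sum>p\<in>index_pairs n. c p) = 0}"

lemma continuous_map_disk_Conf_inclusion: "continuous_map (disk_Conf n r) (Conf n) id"
  by (simp add: disk_Conf_def continuous_map_from_subtopology)

lemma continuous_map_direction:
  assumes "(i, j) \<in> index_pairs n"
  shows "continuous_map (Conf n) circle (direction i j)"
proof -
  have ij: "i \<in> {1..n}" "j \<in> {1..n}" "i \<noteq> j"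
    using assms by (auto simp: index_pairs_def)
  have ne: "x j - x i \<noteq> 0" if "x \<in> topspace (Conf n)" for x
    using that ij by (auto simp: Conf_def dest: inj_onD)
  have proj: "continuous_map (Conf n) euclidean (\<lambda>x. x k)" if "k \<in> {1..n}" for k
    using that unfolding Conf_def
    by (intro continuous_map_from_subtopology continuous_map_product_projection)
  have diff: "continuous_map (Conf n) euclidean (\<lambda>x. x j - x i)"
    using proj ij by (intro continuous_map_diff) auto
  have nm: "continuous_map (Conf n) euclidean (\<lambda>x. inverse (norm (x j - x i)))"
    using ne by (intro continuous_map_real_inverse continuous_map_norm diff) auto
  have "continuous_map (Conf n) euclidean (direction i j)"
    using nm diff unfolding direction_def continuous_map_atin by (auto intro: tendsto_scaleR)
  moreover have "direction i j x \<in> sphere 0 1" if "x \<in> topspace (Conf n)" for x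
    using ne [OF that] by (simp add: direction_def)
  ultimately show ?thesis
    unfolding circle_def by (simp add: continuous_map_in_subtopology image_subset_iff)
qed

end

theory Submission
  imports Defs
begin

text \<open>
  The centres of disjoint disks of radius \<open>r > 1 / 3\<close> in the unit disk lie at distance at most \<open>1 - r\<close> from
  the origin and at distance at least \<open>2 r > 1 - r\<close> from each other. Therefore no centre is at the origin and
  no two centres are on the same ray from the origin (\<open>disk_Conf_angles\<close>). The centres thus have a
  cyclic order around the origin, which is locally constant, and it suffices to kill the classes on the
  subspace belonging to each order: a cocycle that is a coboundary on every piece of an open partition is a
  coboundary (\<open>cohomology_map_trivial_on_pieces\<close>).

  Each piece is contained in a chamber, the space of all configurations in the disk that avoid the
  origin and have a given angular order. A chamber is homotopy equivalent to the circle
  (\<open>homotopy_equivalent_chamber_circle\<close>): the points can be pushed radially to the unit circle and then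
  along it to fixed angles relative to the first point, and what remains is a rotation. So its second
  cohomology vanishes, which disposes of degree 2. In degree 1, every map from the chamber to the circle that
  takes the direction from one point to another is homotopic to the direction of the first point
  (\<open>direction_homotopic_basepoint\<close>). All the generators therefore restrict to the same class, and a
  combination restricts to the sum of its coefficients times that class.

  The passage from homology to cohomology uses only what these two steps require. In degree 2 it is the
  universal coefficient theorem for a path-connected space with infinite cyclic first and trivial second
  homology (\<open>two_cocycle_is_coboundary\<close>). In degree 1 it is the fact that on a path-connected space a
  cochain vanishing on cycles is a coboundary, which yields homotopy invariance in that degree.
\<close>

section \<open>Cochains and additive maps on chains\<close>

lemma cochain_diff:
  assumes "\<phi> \<in> carrier (cochain_group p X)" "singular_chain p X c" "singular_chain p X d"
  shows "\<phi> (c - d) = \<phi> c - \<phi> d"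
proof -
  have "\<phi> ((c - d) + d) = \<phi> (c - d) + \<phi> d"
    using assms singular_chain_diff unfolding carrier_cochain_group by blast
  then show ?thesis by simp
qed

lemma additive_eq_on_chains:
  assumes add: "\<And>c d. \<lbrakk>singular_chain p X c; singular_chain p X d\<rbrakk> \<Longrightarrow> f (c - d) = f c - f d"
      "\<And>c d. \<lbrakk>singular_chain p X c; singular_chain p X d\<rbrakk> \<Longrightarrow> g (c - d) = g c - g d"
    and eq: "\<And>s. singular_simplex p X s \<Longrightarrow> f (frag_of s) = g (frag_of s)"
    and c: "singular_chain p X c"
  shows "f c = (g c :: 'b :: ab_group_add)"
proof -
  have "singular_chain p X c \<and> f c = g c"
    using c[unfolded singular_chain_def]
  proof (induction c rule: frag_induction)
    case zero
    show ?case using add(1)[of 0 0] add(2)[of 0 0] by simp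
  next
    case (one x)
    then show ?case using eq by (simp add: singular_chain_of)
  next
    case (diff a b)
    then show ?case using add singular_chain_diff by metis
  qed
  then show ?thesis ..
qed

lemma coboundaryI:
  assumes \<phi>: "\<phi> \<in> carrier (cochain_group (Suc p) X)"
    and add: "\<And>c d. \<lbrakk>singular_chain p X c; singular_chain p X d\<rbrakk> \<Longrightarrow> \<psi> (c + d) = \<psi> c + \<psi> d"
    and eq: "\<And>c. singular_chain (Suc p) X c \<Longrightarrow> \<phi> c = \<psi> (chain_boundary (Suc p) c)"
  shows "\<phi> \<in> coboundary_set (Suc p) X"
proof -
  let ?\<psi> = "restrict \<psi> (singular_chain_set p X)"
  have "?\<psi> \<in> carrier (cochain_group p X)"
    using add by (auto simp: carrier_cochain_group singular_chain_add)
  moreover have "\<phi> = coboundary p X ?\<psi>"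
    using \<phi> eq by (auto simp: coboundary_def carrier_cochain_group extensional_def fun_eq_iff
        singular_chain_boundary_alt)
  ultimately show ?thesis by auto
qed

section \<open>Cocycles that are coboundaries\<close>

text \<open>
  The chain \<open>s c\<close> joins each point of the 0-chain \<open>c\<close> to a fixed base point by a path. Hence \<open>c - s (\<partial> c)\<close>
  closes a 1-chain \<open>c\<close> up to a cycle, additively in \<open>c\<close>; this splits the cycles off the 1-chains.
\<close>

lemma path_connected_boundary_section:
  assumes "path_connected_space X"
  obtains s where "\<And>c d. s (c + d) = s c + s d"
    "\<And>c. singular_chain 0 X c \<Longrightarrow> singular_chain 1 X (s c)"
    "\<And>c. singular_chain 1 X c \<Longrightarrow> chain_boundary 1 (s (chain_boundary 1 c)) = chain_boundary 1 c"
proof (cases "\<exists>f. singular_simplex 0 X f")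
  case False
  have "c = 0" if "singular_chain 0 X c" for c
  proof -
    have "singular_simplex_set 0 X = {}" using False by blast
    then have "Poly_Mapping.keys c = {}" using that unfolding singular_chain_def by blast
    then show ?thesis by simp
  qed
  then show thesis
    using that[of "\<lambda>_. 0"] singular_chain_boundary_alt[of 0 X] by fastforce
next
  case True
  then obtain b where b: "singular_simplex 0 X b" by blast
  have "\<exists>e. singular_chain 1 X e \<and> chain_boundary 1 e = frag_of f - frag_of b"
    if "singular_simplex 0 X f" for f
    using iso_integer_zeroth_homology_group_aux[OF assms that b]
    by (simp add: homologous_rel_def singular_boundary)
  then obtain e where e: "\<And>f. singular_simplex 0 X f \<Longrightarrow> singular_chain 1 X (e f)"
      "\<And>f. singular_simplex 0 X f \<Longrightarrow> chain_boundary 1 (e f) = frag_of f - frag_of b"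
    by metis
  let ?s = "frag_extend e" and ?aug = "frag_extend (\<lambda>_. frag_of b)"
  have bs: "chain_boundary 1 (?s c) = c - ?aug c" if "singular_chain 0 X c" for c
    by (rule additive_eq_on_chains[OF _ _ _ that])
       (simp_all add: frag_extend_diff chain_boundary_diff e[unfolded One_nat_def])
  have aug: "?aug (chain_boundary 1 c) = 0" if "singular_chain 1 X c" for c
    by (rule additive_eq_on_chains[OF _ _ _ that])
       (simp_all add: frag_extend_diff chain_boundary_diff chain_boundary_of)
  show thesis
  proof (rule that[of ?s])
    show "singular_chain 1 X (?s c)" if "singular_chain 0 X c" for c
      using that e by (intro singular_chain_extend) (auto simp: singular_chain_def)
    show "chain_boundary 1 (?s (chain_boundary 1 c)) = chain_boundary 1 c"
      if "singular_chain 1 X c" for c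
      using bs aug that singular_chain_boundary_alt[of 0 X c] by simp
  qed (rule frag_extend_add)
qed

text \<open>
  In degree 1 a class is determined by its values on cycles, because \<open>H\<^sub>0\<close> is free: coning off to a
  base point turns \<open>\<phi>\<close> into a 0-cochain with coboundary \<open>\<phi>\<close>, up to the value of \<open>\<phi>\<close> on a cycle.
\<close>

lemma cocycle_vanishing_on_cycles_is_coboundary:
  assumes X: "path_connected_space X" and \<phi>: "\<phi> \<in> carrier (cochain_group 1 X)"
    and van: "\<And>z. singular_relcycle 1 X {} z \<Longrightarrow> \<phi> z = 0"
  shows "\<phi> \<in> coboundary_set 1 X"
proof -
  obtain s where add: "\<And>c d. s (c + d) = s c + s d"
    and s: "\<And>c. singular_chain 0 X c \<Longrightarrow> singular_chain 1 X (s c)"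
      "\<And>c. singular_chain 1 X c \<Longrightarrow> chain_boundary 1 (s (chain_boundary 1 c)) = chain_boundary 1 c"
    using path_connected_boundary_section[OF X] by blast
  have "\<phi> \<in> coboundary_set (Suc 0) X"
  proof (rule coboundaryI[where \<psi> = "\<lambda>c. \<phi> (s c)"])
    show "\<phi> \<in> carrier (cochain_group (Suc 0) X)" using \<phi> by simp
    show "\<phi> (s (c + d)) = \<phi> (s c) + \<phi> (s d)" if "singular_chain 0 X c" "singular_chain 0 X d" for c d
      using \<phi> s(1) that unfolding carrier_cochain_group add by blast
    show "\<phi> c = \<phi> (s (chain_boundary (Suc 0) c))" if c: "singular_chain (Suc 0) X c" for c
    proof -
      have sc: "singular_chain 1 X (s (chain_boundary 1 c))"
        using s(1) singular_chain_boundary_alt[OF c] by simp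
      have "singular_relcycle 1 X {} (c - s (chain_boundary 1 c))"
        using c s(2)[of c] sc by (simp add: singular_cycle singular_chain_diff chain_boundary_diff)
      then show ?thesis
        using van cochain_diff[OF \<phi> _ sc, of c] c by simp
    qed
  qed
  then show ?thesis by simp
qed

text \<open>
  The isomorphism with the integers, read off at the level of cycles: a degree relative to a cycle
  \<open>\<gamma>\<close> that represents a generator.
\<close>

lemma infinite_cyclic_homology_degree:
  assumes "homology_group (int p) X \<cong> integer_group"
  obtains deg \<gamma> where "singular_relcycle p X {} \<gamma>"
    "\<And>z w. \<lbrakk>singular_relcycle p X {} z; singular_relcycle p X {} w\<rbrakk> \<Longrightarrow> deg (z + w) = deg z + deg w"
    "\<And>z. singular_relcycle p X {} z \<Longrightarrow> singular_relboundary p X {} (z - frag_cmul (deg z) \<gamma>)"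
    "\<And>z. singular_relboundary p X {} z \<Longrightarrow> deg z = 0"
proof -
  let ?H = "homology_group (int p) X" and ?cl = "homologous_rel_set p X {}"
  obtain h where h: "h \<in> iso ?H integer_group"
    using assms by (auto simp: is_iso_def)
  then have hom: "h \<in> hom ?H integer_group" and inj: "inj_on h (carrier ?H)"
    and surj: "h ` carrier ?H = UNIV"
    by (auto simp: iso_def bij_betw_def)
  have cl: "?cl z \<in> carrier ?H" if "singular_relcycle p X {} z" for z
    using that by (simp add: carrier_relative_homology_group)
  have cl_add: "?cl (z + w) = ?cl z \<otimes>\<^bsub>?H\<^esub> ?cl w"
    if "singular_relcycle p X {} z" "singular_relcycle p X {} w" for z w
    using normal.rcos_sum[OF normal_subgroup_singular_relboundary_relcycle, of z p X "{}" w] that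
    by (simp add: right_coset_singular_relboundary nontrivial_relative_homology_group)
  define deg where "deg z = h (?cl z)" for z
  have deg_add: "deg (z + w) = deg z + deg w"
    if "singular_relcycle p X {} z" "singular_relcycle p X {} w" for z w
    unfolding deg_def cl_add[OF that] using hom_mult[OF hom cl cl] that by simp
  obtain \<gamma> where \<gamma>: "singular_relcycle p X {} \<gamma>" and deg1: "deg \<gamma> = 1"
  proof -
    have "1 \<in> h ` carrier ?H" using surj by simp
    then show thesis using that by (auto simp: carrier_relative_homology_group deg_def)
  qed
  have deg_bd: "deg z = 0" if "singular_relboundary p X {} z" for z
  proof -
    have "?cl z = \<one>\<^bsub>?H\<^esub>" using that by (simp add: homologous_rel_set_eq_relboundary)
    then show ?thesis using hom_one[OF hom] by (simp add: deg_def)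
  qed
  have deg_diff: "deg (z - w) = deg z - deg w"
    if "singular_relcycle p X {} z" "singular_relcycle p X {} w" for z w
    using deg_add[OF singular_relcycle_diff[OF that] that(2)] by simp
  have deg_mult: "deg (frag_cmul n \<gamma>) = n" for n
  proof (induction n rule: int_induct[of _ 0])
    case base
    show ?case using deg_bd[of 0] by simp
  next
    case (step1 i)
    then show ?case
      using \<gamma> deg1 deg_add[of "frag_cmul i \<gamma>" \<gamma>]
      by (simp add: frag_cmul_distrib singular_relcycle_cmul)
  next
    case (step2 i)
    then show ?case
      using \<gamma> deg1 deg_diff[of "frag_cmul i \<gamma>" \<gamma>]
      by (simp add: frag_cmul_diff_distrib singular_relcycle_cmul)
  qed
  have "singular_relboundary p X {} (z - frag_cmul (deg z) \<gamma>)" if z: "singular_relcycle p X {} z" for z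
  proof -
    have g: "singular_relcycle p X {} (frag_cmul (deg z) \<gamma>)" using \<gamma> by (rule singular_relcycle_cmul)
    have "h (?cl (frag_cmul (deg z) \<gamma>)) = h (?cl z)" using deg_mult by (simp add: deg_def)
    then have "?cl (frag_cmul (deg z) \<gamma>) = ?cl z" using inj_onD[OF inj _ cl[OF g] cl[OF z]] by blast
    then show ?thesis by (metis homologous_rel_def homologous_rel_set_eq)
  qed
  then show thesis using that \<gamma> deg_add deg_bd by blast
qed

text \<open>
  This is the part of the universal coefficient theorem that is needed: if \<open>H\<^sub>p\<^sub>+\<^sub>1\<close> vanishes,
  a cocycle \<open>\<phi>\<close> factors through the boundary map, and the retraction \<open>\<rho>\<close> extends the resulting
  homomorphism from the boundaries to all chains. The existence of \<open>\<rho>\<close> replaces the vanishing of the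
  Ext term.
\<close>

lemma cocycle_is_coboundary_if_boundaries_retract:
  assumes \<phi>: "\<phi> \<in> carrier (cocycle_group (Suc p) X)"
    and H: "\<And>z. singular_relcycle (Suc p) X {} z \<Longrightarrow> singular_relboundary (Suc p) X {} z"
    and add: "\<And>c d. \<lbrakk>singular_chain p X c; singular_chain p X d\<rbrakk> \<Longrightarrow> \<rho> (c + d) = \<rho> c + \<rho> d"
    and into: "\<And>c. singular_chain p X c \<Longrightarrow> singular_relboundary p X {} (\<rho> c)"
    and retr: "\<And>z. singular_relboundary p X {} z \<Longrightarrow> \<rho> z = z"
  shows "\<phi> \<in> coboundary_set (Suc p) X"
proof -
  have \<phi>c: "\<phi> \<in> carrier (cochain_group (Suc p) X)" using \<phi> by (simp add: cocycle_iff)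
  \<comment> \<open>The value of \<open>\<phi>\<close> depends on the boundary alone, so \<open>\<phi>\<close> descends to the boundaries.\<close>
  have same: "\<phi> d = \<phi> e" if d: "singular_chain (Suc p) X d" and e: "singular_chain (Suc p) X e"
    and eq: "chain_boundary (Suc p) d = chain_boundary (Suc p) e" for d e
  proof -
    have "singular_relcycle (Suc p) X {} (d - e)"
      using d e eq by (simp add: singular_cycle singular_chain_diff chain_boundary_diff)
    then obtain f where "singular_chain (Suc (Suc p)) X f" "chain_boundary (Suc (Suc p)) f = d - e"
      using H singular_boundary by blast
    then have "\<phi> (d - e) = 0" using \<phi> by (metis cocycle_iff)
    then show ?thesis using cochain_diff[OF \<phi>c d e] by simp
  qed
  obtain l where l: "\<And>c. singular_chain p X c \<Longrightarrow> singular_chain (Suc p) X (l c)"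
      "\<And>c. singular_chain p X c \<Longrightarrow> chain_boundary (Suc p) (l c) = \<rho> c"
    using into unfolding singular_boundary by metis
  show ?thesis
  proof (rule coboundaryI[OF \<phi>c, where \<psi> = "\<lambda>c. \<phi> (l c)"])
    fix c d assume c: "singular_chain p X c" and d: "singular_chain p X d"
    have "\<phi> (l (c + d)) = \<phi> (l c + l d)"
      using c d by (intro same) (simp_all add: l singular_chain_add chain_boundary_add add)
    also have "\<dots> = \<phi> (l c) + \<phi> (l d)"
      using \<phi>c l(1) c d unfolding carrier_cochain_group by blast
    finally show "\<phi> (l (c + d)) = \<phi> (l c) + \<phi> (l d)" .
  next
    fix c assume c: "singular_chain (Suc p) X c"
    then have "singular_relboundary p X {} (chain_boundary (Suc p) c)"
      using singular_boundary by blast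
    then show "\<phi> c = \<phi> (l (chain_boundary (Suc p) c))"
      using c singular_chain_boundary_alt[OF c] by (intro same) (simp_all add: l retr)
  qed
qed

text \<open>
  The retraction of the 1-chains onto the boundaries is the composite of two: closing a chain up to a cycle
  by paths to the base point, and subtracting from a cycle its multiple of the generator \<open>\<gamma>\<close> of
  \<open>H\<^sub>1\<close>.
\<close>

lemma two_cocycle_is_coboundary:
  assumes X: "path_connected_space X" and H1: "homology_group 1 X \<cong> integer_group"
    and H2: "trivial_group (homology_group 2 X)" and \<phi>: "\<phi> \<in> carrier (cocycle_group 2 X)"
  shows "\<phi> \<in> coboundary_set 2 X"
proof -
  obtain s where s_add: "\<And>c d. s (c + d) = s c + s d"
    and s: "\<And>c. singular_chain 0 X c \<Longrightarrow> singular_chain 1 X (s c)"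
      "\<And>c. singular_chain 1 X c \<Longrightarrow> chain_boundary 1 (s (chain_boundary 1 c)) = chain_boundary 1 c"
    using path_connected_boundary_section[OF X] by blast
  have H1': "homology_group (int 1) X \<cong> integer_group" using H1 by simp
  obtain deg \<gamma> where \<gamma>: "singular_relcycle 1 X {} \<gamma>"
    and deg_add: "\<And>z w. \<lbrakk>singular_relcycle 1 X {} z; singular_relcycle 1 X {} w\<rbrakk> \<Longrightarrow> deg (z + w) = deg z + deg w"
    and deg: "\<And>z. singular_relcycle 1 X {} z \<Longrightarrow> singular_relboundary 1 X {} (z - frag_cmul (deg z) \<gamma>)"
    and deg_bd: "\<And>z. singular_relboundary 1 X {} z \<Longrightarrow> deg z = 0"
    by (rule infinite_cyclic_homology_degree[OF H1'], rule that)
  define close where "close c = c - s (chain_boundary 1 c)" for c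
  have close: "singular_relcycle 1 X {} (close c)" if "singular_chain 1 X c" for c
    using that s singular_chain_boundary_alt[of 0 X c]
    by (simp add: close_def singular_cycle singular_chain_diff chain_boundary_diff)
  have close_add: "close (c + d) = close c + close d" for c d
    by (simp add: close_def chain_boundary_add s_add)
  have s0: "s 0 = 0" using s_add[of 0 0] by simp
  have "\<phi> \<in> coboundary_set (Suc 1) X"
  proof (rule cocycle_is_coboundary_if_boundaries_retract
      [where \<rho> = "\<lambda>c. close c - frag_cmul (deg (close c)) \<gamma>"])
    show "\<phi> \<in> carrier (cocycle_group (Suc 1) X)" using \<phi> by (simp add: numeral_2_eq_2)
    fix z assume z: "singular_relcycle (Suc 1) X {} z"
    have "homologous_rel_set 2 X {} z \<in> carrier (homology_group 2 X)"
      using z carrier_relative_homology_group[of 2 X "{}"] by (simp add: numeral_2_eq_2)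
    then have "homologous_rel_set 2 X {} z = singular_relboundary_set 2 X {}"
      using H2 one_relative_homology_group[of 2 X "{}"] by (simp add: trivial_group_def)
    then show "singular_relboundary (Suc 1) X {} z"
      by (simp add: homologous_rel_set_eq_relboundary numeral_2_eq_2)
  next
    fix c d assume "singular_chain 1 X c" "singular_chain 1 X d"
    then have "deg (close (c + d)) = deg (close c) + deg (close d)"
      unfolding close_add using close deg_add by blast
    then show "close (c + d) - frag_cmul (deg (close (c + d))) \<gamma> =
        close c - frag_cmul (deg (close c)) \<gamma> + (close d - frag_cmul (deg (close d)) \<gamma>)"
      by (simp add: close_add frag_cmul_distrib del: minus_frag_cmul)
  next
    fix c assume "singular_chain 1 X c"
    then show "singular_relboundary 1 X {} (close c - frag_cmul (deg (close c)) \<gamma>)"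
      using deg close by blast
  next
    fix z assume z: "singular_relboundary 1 X {} z"
    then have "chain_boundary 1 z = 0"
      using singular_relboundary_imp_relcycle singular_cycle by blast
    then show "close z - frag_cmul (deg (close z)) \<gamma> = z"
      using deg_bd[OF z] by (simp add: close_def s0)
  qed
  then show ?thesis by (simp add: numeral_2_eq_2)
qed

section \<open>Gluing over an open partition\<close>

text \<open>
  The sets on which \<open>l\<close> is constant are open, hence also closed, and the standard simplex is connected.
\<close>

lemma singular_simplex_in_piece:
  assumes op: "\<And>m. openin X {x \<in> topspace X. l x = m}"
    and \<sigma>: "singular_simplex q X \<sigma>" and v: "v \<in> standard_simplex q"
  shows "singular_simplex q (subtopology X {x. l x = l (\<sigma> v)}) \<sigma>"
proof -
  let ?\<Delta> = "subtopology (powertop_real UNIV) (standard_simplex q)"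
  let ?U = "{x \<in> topspace X. l x = l (\<sigma> v)}"
  have cont: "continuous_map ?\<Delta> X \<sigma>" using \<sigma> by (simp add: singular_simplex_def)
  have "topspace X - ?U = (\<Union>m\<in>-{l (\<sigma> v)}. {x \<in> topspace X. l x = m})" by auto
  then have cl: "closedin X ?U" unfolding closedin_def using op by (auto simp: openin_Union)
  let ?T = "{t \<in> topspace ?\<Delta>. \<sigma> t \<in> ?U}"
  have "openin ?\<Delta> ?T" "closedin ?\<Delta> ?T"
    using openin_continuous_map_preimage[OF cont op] closedin_continuous_map_preimage[OF cont cl] by auto
  moreover have "connected_space ?\<Delta>"
    using connectedin_standard_simplex by (simp add: connectedin_def)
  moreover have "v \<in> ?T"
    using v continuous_map_image_subset_topspace[OF cont] by auto
  ultimately have "?T = topspace ?\<Delta>"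
    unfolding connected_space_clopen_in by blast
  then have "l (\<sigma> t) = l (\<sigma> v)" if "t \<in> standard_simplex q" for t
    using that by auto
  then show ?thesis using \<sigma> by (auto simp: singular_simplex_subtopology)
qed

text \<open>
  Each singular simplex lies in one piece, and so do all its faces. A primitive on \<open>X\<close> is therefore
  assembled from primitives on the pieces: on a simplex it is the primitive of the piece of that simplex.
\<close>

lemma coboundary_if_coboundary_on_pieces:
  assumes \<phi>: "\<phi> \<in> carrier (cochain_group (Suc p) X)"
    and op: "\<And>m. openin X {x \<in> topspace X. l x = m}"
    and pieces: "\<And>m. m \<in> l ` topspace X \<Longrightarrow> cochain_map (Suc p) (subtopology X {x. l x = m}) id \<phi>
        \<in> coboundary_set (Suc p) (subtopology X {x. l x = m})"
  shows "\<phi> \<in> coboundary_set (Suc p) X"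
proof -
  define P where "P m = subtopology X {x. l x = m}" for m
  have "\<exists>\<psi>\<in>carrier (cochain_group p (P m)). cochain_map (Suc p) (P m) id \<phi> = coboundary p (P m) \<psi>"
    if "m \<in> l ` topspace X" for m
    using pieces[OF that] unfolding P_def by auto
  then obtain \<psi> where \<psi>: "\<And>m. m \<in> l ` topspace X \<Longrightarrow> \<psi> m \<in> carrier (cochain_group p (P m))"
      "\<And>m. m \<in> l ` topspace X \<Longrightarrow> cochain_map (Suc p) (P m) id \<phi> = coboundary p (P m) (\<psi> m)"
    by metis
  let ?v = "\<lambda>j::nat. if j = 0 then 1 else 0 :: real"
  define label where "label \<sigma> = l (\<sigma> ?v)" for \<sigma>
  \<comment> \<open>A chain over the one-element type is an integer; this makes \<open>frag_extend\<close> extend integer-valued maps.\<close>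
  define \<Psi> where "\<Psi> c = poly_mapping.lookup
      (frag_extend (\<lambda>\<sigma>. frag_cmul (\<psi> (label \<sigma>) (frag_of \<sigma>)) (frag_of ())) c) ()" for c
  have \<Psi>_add: "\<Psi> (c + d) = \<Psi> c + \<Psi> d" for c d
    by (simp add: \<Psi>_def frag_extend_add lookup_add)
  have \<Psi>_diff: "\<Psi> (c - d) = \<Psi> c - \<Psi> d" for c d
    by (simp add: \<Psi>_def frag_extend_diff lookup_minus)
  have in_piece: "singular_simplex q (P (label \<sigma>)) \<sigma>" if "singular_simplex q X \<sigma>" for q \<sigma>
    unfolding P_def label_def using op that by (rule singular_simplex_in_piece) simp
  have label: "label \<sigma> = m" if "singular_simplex q (P m) \<sigma>" for q \<sigma> m
    using that basis_in_standard_simplex[of 0 q] unfolding P_def label_def singular_simplex_subtopology by blast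
  have \<Psi>_piece: "\<Psi> c = \<psi> m c" if m: "m \<in> l ` topspace X" and c: "singular_chain p (P m) c" for m c
  proof (rule additive_eq_on_chains[OF _ _ _ c])
    show "\<Psi> (frag_of \<sigma>) = \<psi> m (frag_of \<sigma>)" if "singular_simplex p (P m) \<sigma>" for \<sigma>
      using label[OF that] by (simp add: \<Psi>_def)
  qed (auto simp: \<Psi>_diff cochain_diff[OF \<psi>(1)[OF m]])
  show ?thesis
  proof (rule coboundaryI[OF \<phi> \<Psi>_add])
    fix c assume c: "singular_chain (Suc p) X c"
    show "\<phi> c = \<Psi> (chain_boundary (Suc p) c)"
    proof (rule additive_eq_on_chains[OF _ _ _ c])
      fix \<sigma> assume \<sigma>: "singular_simplex (Suc p) X \<sigma>"
      define m where "m = label \<sigma>"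
      have "\<sigma> ?v \<in> topspace X"
        using \<sigma> basis_in_standard_simplex[of 0 "Suc p"]
        by (auto simp: singular_simplex_def continuous_map_def Pi_iff)
      then have mL: "m \<in> l ` topspace X" by (simp add: m_def label_def)
      have \<sigma>m: "singular_chain (Suc p) (P m) (frag_of \<sigma>)"
        using in_piece[OF \<sigma>] by (simp add: singular_chain_of m_def)
      have "\<phi> (frag_of \<sigma>) = cochain_map (Suc p) (P m) id \<phi> (frag_of \<sigma>)"
        using \<sigma>m by (simp add: cochain_map_def chain_map_ident del: chain_map_of)
      also have "\<dots> = \<psi> m (chain_boundary (Suc p) (frag_of \<sigma>))"
        using \<sigma>m by (simp add: \<psi>(2)[OF mL] coboundary_def)
      also have "\<dots> = \<Psi> (chain_boundary (Suc p) (frag_of \<sigma>))"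
        using \<Psi>_piece[OF mL] singular_chain_boundary_alt[OF \<sigma>m] by simp
      finally show "\<phi> (frag_of \<sigma>) = \<Psi> (chain_boundary (Suc p) (frag_of \<sigma>))" .
    qed (auto simp: cochain_diff[OF \<phi>] chain_boundary_diff \<Psi>_diff)
  qed
qed

section \<open>Induced maps on cohomology classes\<close>

lemma cohomology_class_obtain:
  assumes "A \<in> carrier (cohomology_group p X)"
  obtains \<phi> where "\<phi> \<in> carrier (cocycle_group p X)"
    "A = coboundary_set p X #>\<^bsub>cocycle_group p X\<^esub> \<phi>"
  using assms that by (auto simp: cohomology_group_def carrier_FactGroup)

lemma one_cohomology_group: "\<one>\<^bsub>cohomology_group p X\<^esub> = coboundary_set p X"
  by (simp add: cohomology_group_def)

lemma cohomology_class_trivial_iff: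
  assumes "\<phi> \<in> carrier (cocycle_group p X)"
  shows "coboundary_set p X #>\<^bsub>cocycle_group p X\<^esub> \<phi> = \<one>\<^bsub>cohomology_group p X\<^esub>
    \<longleftrightarrow> \<phi> \<in> coboundary_set p X"
proof -
  interpret comm_group "cocycle_group p X" by (rule comm_group_cocycle_group)
  show ?thesis
    unfolding one_cohomology_group
    using coset_join1[OF _ assms subgroup_coboundary_set] coset_join2[OF assms subgroup_coboundary_set]
    by blast
qed

lemma cochain_map_in_cocycle:
  assumes "continuous_map X Y f" "\<phi> \<in> carrier (cocycle_group p Y)"
  shows "cochain_map p X f \<phi> \<in> carrier (cocycle_group p X)"
  using hom_in_carrier[OF cochain_map_cocycle_hom[OF assms(1)] assms(2)] .

lemma cohomology_map_trivial_iff: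
  assumes "continuous_map X Y f" "\<phi> \<in> carrier (cocycle_group p Y)"
  shows "cohomology_map p X f (coboundary_set p Y #>\<^bsub>cocycle_group p Y\<^esub> \<phi>) = \<one>\<^bsub>cohomology_group p X\<^esub>
    \<longleftrightarrow> cochain_map p X f \<phi> \<in> coboundary_set p X"
  unfolding cohomology_map_class[OF assms]
  by (rule cohomology_class_trivial_iff[OF cochain_map_in_cocycle[OF assms]])

lemma cochain_map_compose:
  assumes "continuous_map X Y f"
  shows "cochain_map p X f (cochain_map p Y g \<phi>) = cochain_map p X (g \<circ> f) \<phi>"
  using assms
  by (auto simp: cochain_map_def fun_eq_iff singular_chain_chain_map chain_map_compose)

lemma cohomology_map_compose:
  assumes f: "continuous_map X Y f" and g: "continuous_map Y Z g"
    and A: "A \<in> carrier (cohomology_group p Z)"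
  shows "cohomology_map p X f (cohomology_map p Y g A) = cohomology_map p X (g \<circ> f) A"
proof -
  obtain \<phi> where \<phi>: "\<phi> \<in> carrier (cocycle_group p Z)"
    and A: "A = coboundary_set p Z #>\<^bsub>cocycle_group p Z\<^esub> \<phi>"
    using A by (rule cohomology_class_obtain)
  show ?thesis
    unfolding A cohomology_map_class[OF g \<phi>] cohomology_map_class[OF f cochain_map_in_cocycle[OF g \<phi>]]
      cohomology_map_class[OF continuous_map_compose[OF f g] \<phi>] cochain_map_compose[OF f] ..
qed

lemma cohomology_map_trivial_on_pieces:
  assumes f: "continuous_map X Y f" and A: "A \<in> carrier (cohomology_group (Suc p) Y)"
    and op: "\<And>m. openin X {x \<in> topspace X. l x = m}"
    and pieces: "\<And>m. m \<in> l ` topspace X \<Longrightarrow> cohomology_map (Suc p) (subtopology X {x. l x = m}) f A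
        = \<one>\<^bsub>cohomology_group (Suc p) (subtopology X {x. l x = m})\<^esub>"
  shows "cohomology_map (Suc p) X f A = \<one>\<^bsub>cohomology_group (Suc p) X\<^esub>"
proof -
  obtain \<phi> where \<phi>: "\<phi> \<in> carrier (cocycle_group (Suc p) Y)"
    and A: "A = coboundary_set (Suc p) Y #>\<^bsub>cocycle_group (Suc p) Y\<^esub> \<phi>"
    using A by (rule cohomology_class_obtain)
  have "cochain_map (Suc p) X f \<phi> \<in> coboundary_set (Suc p) X"
  proof (rule coboundary_if_coboundary_on_pieces[OF _ op])
    show "cochain_map (Suc p) X f \<phi> \<in> carrier (cochain_group (Suc p) X)"
      using cochain_map_in_cocycle[OF f \<phi>] cocycle_iff by blast
    fix m assume m: "m \<in> l ` topspace X"
    let ?P = "subtopology X {x. l x = m}"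
    have i: "continuous_map ?P X id" and fP: "continuous_map ?P Y f"
      using f by (simp_all add: continuous_map_from_subtopology)
    show "cochain_map (Suc p) ?P id (cochain_map (Suc p) X f \<phi>) \<in> coboundary_set (Suc p) ?P"
      using pieces[OF m] unfolding A cohomology_map_trivial_iff[OF fP \<phi>] cochain_map_compose[OF i]
      by simp
  qed
  then show ?thesis unfolding A cohomology_map_trivial_iff[OF f \<phi>] .
qed

text \<open>
  Homotopic maps carry a cycle to homologous cycles, so the pullbacks of a cocycle differ by a cochain that
  vanishes on cycles. In degree 1 this suffices, and no chain homotopy has to be constructed.
\<close>

lemma homotopic_imp_cohomology_map_eq_degree_1:
  assumes X: "path_connected_space X" and hom: "homotopic_with (\<lambda>_. True) X Y f g"
    and A: "A \<in> carrier (cohomology_group 1 Y)"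
  shows "cohomology_map 1 X f A = cohomology_map 1 X g A"
proof -
  obtain \<phi> where \<phi>: "\<phi> \<in> carrier (cocycle_group 1 Y)"
    and A: "A = coboundary_set 1 Y #>\<^bsub>cocycle_group 1 Y\<^esub> \<phi>"
    using A by (rule cohomology_class_obtain)
  have \<phi>c: "\<phi> \<in> carrier (cochain_group 1 Y)" using \<phi> cocycle_iff by blast
  have f: "continuous_map X Y f" and g: "continuous_map X Y g"
    using homotopic_with_imp_continuous_maps[OF hom] by auto
  interpret comm_group "cocycle_group 1 X" by (rule comm_group_cocycle_group)
  note cf = cochain_map_in_cocycle[OF f \<phi>] and cg = cochain_map_in_cocycle[OF g \<phi>]
  define \<beta> where "\<beta> = (\<lambda>c\<in>singular_chain_set 1 X. \<phi> (chain_map 1 f c) - \<phi> (chain_map 1 g c))"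
  have cfc: "cochain_map 1 X f \<phi> \<in> carrier (cochain_group 1 X)"
    and cgc: "cochain_map 1 X g \<phi> \<in> carrier (cochain_group 1 X)"
    using cf cg cocycle_iff by blast+
  have \<beta>: "\<beta> \<in> coboundary_set 1 X"
  proof (rule cocycle_vanishing_on_cycles_is_coboundary[OF X])
    show "\<beta> \<in> carrier (cochain_group 1 X)"
      using cfc cgc by (auto simp: carrier_cochain_group \<beta>_def cochain_map_def singular_chain_add)
    fix z assume z: "singular_relcycle 1 X {} z"
    then have zc: "singular_chain 1 X z" by (simp add: singular_cycle)
    have "homologous_rel 1 Y {} (chain_map 1 f z) (chain_map 1 g z)"
      using homotopic_imp_homologous_rel_chain_maps[where V = "{}", OF _ z] hom by simp
    then obtain d where "singular_chain 2 Y d" "chain_boundary 2 d = chain_map 1 f z - chain_map 1 g z"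
      by (auto simp: homologous_rel_def singular_boundary numeral_2_eq_2)
    then have "\<phi> (chain_map 1 f z - chain_map 1 g z) = 0"
      using \<phi> unfolding cocycle_iff by (metis Suc_1)
    then show "\<beta> z = 0"
      using cochain_diff[OF \<phi>c, of "chain_map 1 f z" "chain_map 1 g z"] zc
      by (simp add: \<beta>_def singular_chain_chain_map[OF _ f] singular_chain_chain_map[OF _ g])
  qed
  have "cochain_map 1 X f \<phi> = \<beta> \<otimes>\<^bsub>cocycle_group 1 X\<^esub> cochain_map 1 X g \<phi>"
    by (auto simp: \<beta>_def cochain_map_def fun_eq_iff)
  then have "cochain_map 1 X f \<phi> \<in> coboundary_set 1 X #>\<^bsub>cocycle_group 1 X\<^esub> cochain_map 1 X g \<phi>"
    using \<beta> unfolding r_coset_def by blast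
  then show ?thesis
    unfolding A cohomology_map_class[OF f \<phi>] cohomology_map_class[OF g \<phi>]
    using repr_independence[OF _ cg subgroup_coboundary_set] by metis
qed

section \<open>Rotations of the plane and the circle\<close>

definition to_complex :: "real ^ 2 \<Rightarrow> complex" where
  "to_complex v = Complex (v $ 1) (v $ 2)"

text \<open>
  Rotation by the angle \<open>a\<close>; under the identification of the plane with the complex numbers it is
  multiplication by \<open>cis a\<close>.
\<close>

definition spin :: "real \<Rightarrow> real ^ 2 \<Rightarrow> real ^ 2" where
  "spin a v = vector [cos a * v $ 1 - sin a * v $ 2, sin a * v $ 1 + cos a * v $ 2]"

lemma to_complex_eq_iff [simp]: "to_complex v = to_complex w \<longleftrightarrow> v = w"
  by (auto simp: to_complex_def vec_eq_iff forall_2)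

lemma to_complex_scaleR [simp]: "to_complex (a *\<^sub>R v) = of_real a * to_complex v"
  by (simp add: to_complex_def complex_eq_iff)

lemma to_complex_diff [simp]: "to_complex (v - w) = to_complex v - to_complex w"
  by (simp add: to_complex_def complex_eq_iff)

lemma to_complex_0 [simp]: "to_complex 0 = 0"
  by (simp add: to_complex_def complex_eq_iff)

lemma to_complex_eq_0_iff [simp]: "to_complex v = 0 \<longleftrightarrow> v = 0"
  using to_complex_eq_iff[of v 0] by simp

lemma to_complex_spin [simp]: "to_complex (spin a v) = cis a * to_complex v"
  by (simp add: to_complex_def spin_def complex_eq_iff)

lemma norm_to_complex [simp]: "norm (to_complex v) = norm v"
  by (simp add: to_complex_def norm_vec_def L2_set_def sum_2 cmod_def)

lemma norm_spin [simp]: "norm (spin a v) = norm v"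
  by (metis norm_to_complex to_complex_spin norm_mult norm_cis mult_1)

lemma spin_0 [simp]: "spin 0 v = v"
  by (metis to_complex_eq_iff to_complex_spin cis_zero mult_1)

lemma tendsto_to_complex:
  "(f \<longlongrightarrow> l) F \<Longrightarrow> ((\<lambda>x. to_complex (f x)) \<longlongrightarrow> to_complex l) F"
  unfolding to_complex_def by (intro tendsto_intros)

lemma tendsto_spin:
  assumes "(a \<longlongrightarrow> b) F" "(v \<longlongrightarrow> w) F"
  shows "((\<lambda>x. spin (a x) (v x)) \<longlongrightarrow> spin b w) F"
proof (rule vec_tendstoI)
  fix i :: 2
  have "spin c u $ 1 = cos c * u $ 1 - sin c * u $ 2"
    "spin c u $ 2 = sin c * u $ 1 + cos c * u $ 2" for c u
    by (simp_all add: spin_def)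
  moreover have "((\<lambda>x. cos (a x) * v x $ 1 - sin (a x) * v x $ 2) \<longlongrightarrow> cos b * w $ 1 - sin b * w $ 2) F"
    "((\<lambda>x. sin (a x) * v x $ 1 + cos (a x) * v x $ 2) \<longlongrightarrow> sin b * w $ 1 + cos b * w $ 2) F"
    by (intro tendsto_add tendsto_diff tendsto_mult tendsto_vec_nth assms
        isCont_tendsto_compose[OF isCont_cos] isCont_tendsto_compose[OF isCont_sin])+
  ultimately show "((\<lambda>x. spin (a x) (v x) $ i) \<longlongrightarrow> spin b w $ i) F"
    using exhaust_2[of i] by auto
qed

lemma continuous_map_tendsto_iff:
  "continuous_map X euclidean f \<longleftrightarrow> (\<forall>x\<in>topspace X. (f \<longlongrightarrow> f x) (atin X x))"
  by (simp add: continuous_map_atin)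

lemma path_connected_space_circle: "path_connected_space circle"
proof -
  have "path_connected (sphere (0 :: real ^ 2) 1)" by (intro path_connected_sphere) simp
  then have "path_connectedin euclidean (sphere (0 :: real ^ 2) 1)" by simp
  then show ?thesis unfolding circle_def path_connectedin_def by simp
qed

lemma homology_group_circle:
  "homology_group 1 circle \<cong> integer_group" "trivial_group (homology_group 2 circle)"
proof -
  have "independent (Basis :: (real ^ 2) set)" by (rule independent_Basis)
  moreover have "pairwise orthogonal (Basis :: (real ^ 2) set)" by (rule orthogonal_Basis)
  moreover have "card (Basis :: (real ^ 2) set) = 2" by simp
  ultimately obtain f :: "(nat \<Rightarrow> real) \<Rightarrow> real ^ 2" and g
    where "homeomorphic_maps (nsphere (2 - 1)) (top_of_set (sphere 0 1 \<inter> span Basis)) f g"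
    using homeomorphic_maps_nsphere_euclidean_sphere[of "Basis :: (real ^ 2) set" 2] by force
  then have hom: "nsphere 1 homeomorphic_space circle"
    unfolding circle_def homeomorphic_space_def by auto
  have iso: "homology_group p circle \<cong> reduced_homology_group p (nsphere 1)" if "p \<noteq> 0" for p
    using homeomorphic_space_imp_isomorphic_homology_groups hom homeomorphic_space_sym
    by (metis that un_reduced_homology_group)
  show "homology_group 1 circle \<cong> integer_group"
    using iso[of 1] reduced_homology_group_nsphere(1)[of 1] iso_trans by auto
  show "trivial_group (homology_group 2 circle)"
    using isomorphic_group_triviality[OF iso[of 2]] reduced_homology_group_nsphere(2)[of 2 1] by simp
qed

section \<open>Configurations with points on distinct rays\<close>

text \<open>
  The angle at the origin from the first point of the configuration to the \<open>k\<close>-th, in the range from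
  \<open>0\<close> to \<open>2\<pi>\<close>. Measuring from a point of the configuration makes the angle invariant under rotation, and
  makes it continuous as long as no other point has the direction of the first one.
\<close>

definition angle :: "(nat \<Rightarrow> real ^ 2) \<Rightarrow> nat \<Rightarrow> real" where
  "angle x k = Arg2pi (to_complex (x k) / to_complex (x 1))"

text \<open>
  Configurations that avoid the origin and whose points are met in the order prescribed by \<open>\<beta>\<close> when a
  ray is turned once around the origin, starting at the first point.
\<close>

definition chamber :: "nat \<Rightarrow> (nat \<Rightarrow> real) \<Rightarrow> (nat \<Rightarrow> real ^ 2) topology" where
  "chamber n \<beta> = subtopology (Conf n)
     {x. (\<forall>k\<in>{1..n}. x k \<noteq> 0) \<and>
         (\<forall>j\<in>{1..n}. \<forall>k\<in>{1..n}. angle x j < angle x k \<longleftrightarrow> \<beta> j < \<beta> k)}"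

lemma topspace_Conf:
  "x \<in> topspace (Conf n) \<longleftrightarrow> x \<in> extensional {1..n} \<and> (\<forall>k\<in>{1..n}. norm (x k) \<le> 1) \<and> inj_on x {1..n}"
  by (auto simp: Conf_def PiE_def)

lemma topspace_chamber:
  "x \<in> topspace (chamber n \<beta>) \<longleftrightarrow> x \<in> topspace (Conf n) \<and> (\<forall>k\<in>{1..n}. x k \<noteq> 0) \<and>
         (\<forall>j\<in>{1..n}. \<forall>k\<in>{1..n}. angle x j < angle x k \<longleftrightarrow> \<beta> j < \<beta> k)"
  by (simp add: chamber_def)

lemma angle_bounds: "0 \<le> angle x k" "angle x k < 2 * pi"
  using Arg2pi by (auto simp: angle_def)

lemma angle_1: "x 1 \<noteq> 0 \<Longrightarrow> angle x 1 = 0"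
  by (simp add: angle_def Arg2pi_eq_0)

lemma angle_polar:
  assumes "u \<noteq> 0" "0 < r" "0 < s" "x k = r *\<^sub>R spin a u" "x 1 = s *\<^sub>R u" "0 \<le> a" "a < 2 * pi"
  shows "angle x k = a"
  unfolding angle_def
proof (rule Arg2pi_unique)
  show "of_real (r / s) * exp (\<i> * of_real a) = to_complex (x k) / to_complex (x 1)"
    using assms by (simp add: cis_conv_exp field_simps)
qed (use assms in auto)

text \<open>
  Points on distinct rays are distinct whatever their radii, so the radii are free in a chamber and the angles
  only have to keep their order.
\<close>

lemma polar_in_chamber:
  assumes n: "1 \<le> n" and inj: "inj_on \<beta> {1..n}" and u: "norm u = 1"
    and r: "\<And>k. k \<in> {1..n} \<Longrightarrow> 0 < r k \<and> r k \<le> 1"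
    and a: "\<And>k. k \<in> {1..n} \<Longrightarrow> 0 \<le> a k \<and> a k < 2 * pi" and a1: "a 1 = 0"
    and ord: "\<And>j k. \<lbrakk>j \<in> {1..n}; k \<in> {1..n}; \<beta> j < \<beta> k\<rbrakk> \<Longrightarrow> a j < a k"
  shows "(\<lambda>k\<in>{1..n}. r k *\<^sub>R spin (a k) u) \<in> topspace (chamber n \<beta>)" (is "?x \<in> _")
proof -
  have u0: "u \<noteq> 0" using u by auto
  have ang: "angle ?x k = a k" if "k \<in> {1..n}" for k
    using that n r[of 1] r[OF that] a[OF that] a1
    by (intro angle_polar[OF u0, where r = "r k" and s = "r 1"]) auto
  have iff: "a j < a k \<longleftrightarrow> \<beta> j < \<beta> k" if "j \<in> {1..n}" "k \<in> {1..n}" for j k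
    using that ord[of j k] ord[of k j] inj_onD[OF inj, of j k] by (metis linorder_less_linear order_less_asym)
  have "inj_on a {1..n}"
    by (rule inj_onI) (metis iff inj inj_onD less_irrefl linorder_less_linear)
  then have "inj_on (angle ?x) {1..n}"
    using ang inj_on_cong by blast
  moreover have "angle ?x i = angle ?x j" if "?x i = ?x j" for i j
    unfolding angle_def that ..
  ultimately have "inj_on ?x {1..n}"
    unfolding inj_on_def by blast
  moreover have "norm (?x k) \<le> 1" "?x k \<noteq> 0" if "k \<in> {1..n}" for k
  proof -
    have "norm (?x k) = r k" using r[OF that] that u by simp
    then show "norm (?x k) \<le> 1" "?x k \<noteq> 0" using r[OF that] by auto
  qed
  ultimately show ?thesis
    unfolding topspace_chamber topspace_Conf using ang iff by auto
qed

lemma config_polar: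
  assumes "x 1 \<noteq> 0" "x k \<noteq> 0"
  shows "x k = norm (x k) *\<^sub>R spin (angle x k) (x 1 /\<^sub>R norm (x 1))"
proof -
  have "to_complex (x k) / to_complex (x 1) =
      of_real (norm (x k) / norm (x 1)) * cis (angle x k)"
    using Arg2pi_eq[of "to_complex (x k) / to_complex (x 1)"]
    by (simp add: angle_def norm_divide cis_conv_exp)
  then have "to_complex (x k) = to_complex (norm (x k) *\<^sub>R spin (angle x k) (x 1 /\<^sub>R norm (x 1)))"
    using assms by (simp add: field_simps)
  then show ?thesis by (simp only: to_complex_eq_iff)
qed

lemma continuous_map_coordinate:
  "k \<in> {1..n} \<Longrightarrow> continuous_map (Conf n) euclidean (\<lambda>x. x k)"
  unfolding Conf_def
  by (intro continuous_map_from_subtopology continuous_map_product_projection) auto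

lemma continuous_map_angle:
  assumes X: "\<And>x. x \<in> topspace X \<Longrightarrow> x 1 \<noteq> 0 \<and> x k \<noteq> 0 \<and> (k \<noteq> 1 \<longrightarrow> angle x k \<noteq> 0)"
    and c: "continuous_map X euclidean (\<lambda>x. x 1)" "continuous_map X euclidean (\<lambda>x. x k)"
  shows "continuous_map X euclideanreal (\<lambda>x. angle x k)"
proof (cases "k = 1")
  case True
  show ?thesis
    by (rule continuous_map_eq[of _ _ "\<lambda>_. 0"]) (use X angle_1 True in auto)
next
  case False
  show ?thesis
    unfolding continuous_map_tendsto_iff
  proof
    fix x assume x: "x \<in> topspace X"
    have "to_complex (x k) / to_complex (x 1) \<notin> \<real>\<^sub>\<ge>\<^sub>0"
      using X[OF x] False unfolding angle_def
      by (metis Arg2pi_eq_0 complex_is_Real_iff complex_nonneg_Reals_iff)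
    then have "isCont Arg2pi (to_complex (x k) / to_complex (x 1))"
      by (rule continuous_at_Arg2pi)
    moreover have "((\<lambda>y. to_complex (y k) / to_complex (y 1)) \<longlongrightarrow> to_complex (x k) / to_complex (x 1)) (atin X x)"
      using c x X[OF x] unfolding continuous_map_tendsto_iff
      by (intro tendsto_divide tendsto_to_complex) auto
    ultimately show "((\<lambda>x. angle x k) \<longlongrightarrow> angle x k) (atin X x)"
      unfolding angle_def by (rule isCont_tendsto_compose)
  qed
qed

section \<open>Chambers are homotopy equivalent to the circle\<close>

text \<open>
  Angles that occur in a configuration with points on distinct rays, normalised to start at the first point.
\<close>

locale angle_pattern =
  fixes n :: nat and \<beta> :: "nat \<Rightarrow> real"
  assumes n: "1 \<le> n" and inj: "inj_on \<beta> {1..n}" and \<beta>1: "\<beta> 1 = 0"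
    and \<beta>: "\<And>k. k \<in> {1..n} \<Longrightarrow> 0 \<le> \<beta> k \<and> \<beta> k < 2 * pi"
begin

text \<open>
  The maps of the homotopy equivalence between chamber and circle: \<open>basepoint\<close> records the direction of
  the first point, and \<open>rigid\<close> rotates the configuration on the unit circle with angles \<open>\<beta>\<close>.
  The homotopy moves the radii linearly to 1 and the angles linearly to \<open>\<beta>\<close>.
\<close>

definition "basepoint (x :: nat \<Rightarrow> real ^ 2) = x 1 /\<^sub>R norm (x 1)"

definition "rigid z = (\<lambda>k\<in>{1..n}. spin (\<beta> k) z)"

definition "polar_homotopy = (\<lambda>(t, x). \<lambda>k\<in>{1..n}.
   ((1 - t) * norm (x k) + t) *\<^sub>R spin ((1 - t) * angle x k + t * \<beta> k) (basepoint x))"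

lemma chamberD:
  assumes "x \<in> topspace (chamber n \<beta>)"
  shows "x 1 \<noteq> 0" "k \<in> {1..n} \<Longrightarrow> x k \<noteq> 0" "k \<in> {1..n} \<Longrightarrow> norm (x k) \<le> 1"
    "x \<in> extensional {1..n}" "norm (basepoint x) = 1" "angle x 1 = 0"
    "\<lbrakk>j \<in> {1..n}; k \<in> {1..n}\<rbrakk> \<Longrightarrow> angle x j < angle x k \<longleftrightarrow> \<beta> j < \<beta> k"
  using assms n angle_1[of x] by (auto simp: topspace_chamber topspace_Conf basepoint_def)

lemma continuous_map_chamber_coordinate:
  "k \<in> {1..n} \<Longrightarrow> continuous_map (chamber n \<beta>) euclidean (\<lambda>x. x k)"
  unfolding chamber_def by (intro continuous_map_from_subtopology continuous_map_coordinate)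

lemma continuous_map_chamber_angle:
  assumes k: "k \<in> {1..n}"
  shows "continuous_map (chamber n \<beta>) euclideanreal (\<lambda>x. angle x k)"
proof (rule continuous_map_angle)
  fix x assume x: "x \<in> topspace (chamber n \<beta>)"
  have "angle x k \<noteq> 0" if "k \<noteq> 1"
  proof -
    have "0 < \<beta> k" using \<beta>[OF k] \<beta>1 inj_onD[OF inj, of k 1] n k that by force
    then show ?thesis using chamberD(6,7)[OF x] k n \<beta>1 by (metis atLeastAtMost_iff less_irrefl order_refl)
  qed
  then show "x 1 \<noteq> 0 \<and> x k \<noteq> 0 \<and> (k \<noteq> 1 \<longrightarrow> angle x k \<noteq> 0)"
    using chamberD[OF x] k by blast
qed (use continuous_map_chamber_coordinate k n in auto)

lemma continuous_map_basepoint: "continuous_map (chamber n \<beta>) circle basepoint"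
proof -
  have c: "continuous_map (chamber n \<beta>) euclidean (\<lambda>x. x 1)"
    using continuous_map_chamber_coordinate n by simp
  have "continuous_map (chamber n \<beta>) euclidean basepoint"
    using c chamberD(1) unfolding continuous_map_tendsto_iff basepoint_def
    by (intro ballI tendsto_scaleR tendsto_inverse tendsto_norm) auto
  then show ?thesis
    using chamberD(5) unfolding circle_def by (auto simp: continuous_map_in_subtopology)
qed

lemma continuous_map_into_chamber:
  assumes "\<And>y. y \<in> topspace Y \<Longrightarrow> f y \<in> topspace (chamber n \<beta>)"
    and "\<And>k. k \<in> {1..n} \<Longrightarrow> continuous_map Y euclidean (\<lambda>y. f y k)"
  shows "continuous_map Y (chamber n \<beta>) f"
  using assms unfolding chamber_def Conf_def
  by (auto simp: continuous_map_in_subtopology continuous_map_componentwise PiE_def image_subset_iff)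

lemma continuous_map_rigid: "continuous_map circle (chamber n \<beta>) rigid"
proof (rule continuous_map_into_chamber)
  show "rigid z \<in> topspace (chamber n \<beta>)" if "z \<in> topspace circle" for z
    using polar_in_chamber[OF n inj, of z "\<lambda>_. 1" \<beta>] that \<beta> \<beta>1 by (simp add: rigid_def circle_def)
  show "continuous_map circle euclidean (\<lambda>z. rigid z k)" if "k \<in> {1..n}" for k
  proof -
    have "continuous_map circle euclidean (\<lambda>z. z)" by (simp add: circle_def)
    then have "continuous_map circle euclidean (\<lambda>z. spin (\<beta> k) z)"
      unfolding continuous_map_tendsto_iff by (auto intro!: tendsto_spin)
    then show ?thesis using that by (simp add: rigid_def)
  qed
qed

lemma continuous_map_polar_homotopy:
  "continuous_map (prod_topology (top_of_set {0..1}) (chamber n \<beta>)) (chamber n \<beta>) polar_homotopy"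
proof (rule continuous_map_into_chamber)
  fix p assume "p \<in> topspace (prod_topology (top_of_set {0..1::real}) (chamber n \<beta>))"
  then obtain t x where p: "p = (t, x)" and t: "0 \<le> t" "t \<le> 1" and x: "x \<in> topspace (chamber n \<beta>)"
    by (cases p) (simp only: topspace_prod_topology topspace_euclidean_subtopology mem_Times_iff
        fst_conv snd_conv atLeastAtMost_iff)
  note D = chamberD[OF x]
  have comb: "0 \<le> (1 - t) * angle x k + t * \<beta> k \<and> (1 - t) * angle x k + t * \<beta> k < 2 * pi"
    if "k \<in> {1..n}" for k
    using t \<beta>[OF that] angle_bounds[of x k] convex_bound_lt[of "angle x k" "2 * pi" "\<beta> k" "1 - t" t] by simp
  have rad: "0 < (1 - t) * norm (x k) + t \<and> (1 - t) * norm (x k) + t \<le> 1" if "k \<in> {1..n}" for k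
  proof
    show "(1 - t) * norm (x k) + t \<le> 1"
      using t D(3)[OF that] convex_bound_le[of "norm (x k)" 1 1 "1 - t" t] by simp
    show "0 < (1 - t) * norm (x k) + t"
      using t D(2)[OF that] by (cases "t = 0") (auto simp: add_nonneg_pos)
  qed
  \<comment> \<open>Two tuples in the same order have all their convex combinations in that order.\<close>
  have ord: "(1 - t) * angle x j + t * \<beta> j < (1 - t) * angle x k + t * \<beta> k"
    if "j \<in> {1..n}" "k \<in> {1..n}" "\<beta> j < \<beta> k" for j k
  proof -
    have "angle x j < angle x k" using D(7) that by blast
    then show ?thesis
      using t that(3) by (cases "t = 0") (auto intro!: add_le_less_mono mult_left_mono mult_strict_left_mono)
  qed
  show "polar_homotopy p \<in> topspace (chamber n \<beta>)"
    unfolding polar_homotopy_def p prod.case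
  proof (rule polar_in_chamber[OF n inj D(5) rad comb _ ord])
    show "(1 - t) * angle x 1 + t * \<beta> 1 = 0" unfolding D(6) \<beta>1 by simp
  qed
next
  fix k assume k: "k \<in> {1..n}"
  let ?P = "prod_topology (top_of_set {0..1::real}) (chamber n \<beta>)"
  have t: "continuous_map ?P euclideanreal fst"
    by (rule continuous_map_into_fulltopology[OF continuous_map_fst])
  have x: "continuous_map ?P euclidean (\<lambda>p. snd p k)"
    using continuous_map_compose[OF continuous_map_snd continuous_map_chamber_coordinate[OF k]]
    by (simp add: o_def)
  have a: "continuous_map ?P euclideanreal (\<lambda>p. angle (snd p) k)"
    using continuous_map_compose[OF continuous_map_snd continuous_map_chamber_angle[OF k]]
    by (simp add: o_def)
  have "continuous_map (chamber n \<beta>) euclidean basepoint"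
    using continuous_map_basepoint unfolding circle_def by (rule continuous_map_into_fulltopology)
  from continuous_map_compose[OF continuous_map_snd this]
  have b: "continuous_map ?P euclidean (\<lambda>p. basepoint (snd p))"
    by (simp add: o_def)
  have "continuous_map ?P euclidean (\<lambda>p. ((1 - fst p) * norm (snd p k) + fst p) *\<^sub>R
      spin ((1 - fst p) * angle (snd p) k + fst p * \<beta> k) (basepoint (snd p)))"
    using t x a b unfolding continuous_map_tendsto_iff
    by (intro ballI tendsto_scaleR tendsto_spin tendsto_add tendsto_mult tendsto_diff tendsto_norm
        tendsto_const) blast+
  then show "continuous_map ?P euclidean (\<lambda>p. polar_homotopy p k)"
    using k by (simp add: polar_homotopy_def case_prod_beta)
qed

lemma rigid_basepoint_homotopic_id:
  "homotopic_with (\<lambda>_. True) (chamber n \<beta>) (chamber n \<beta>) id (rigid \<circ> basepoint)"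
proof -
  have "polar_homotopy (0, x) = x" if "x \<in> topspace (chamber n \<beta>)" for x
  proof
    fix k
    show "polar_homotopy (0, x) k = x k"
      using chamberD[OF that] config_polar[of x k]
      by (auto simp: polar_homotopy_def basepoint_def extensional_def)
  qed
  moreover have "polar_homotopy (1, x) = (rigid \<circ> basepoint) x" for x
    by (simp add: polar_homotopy_def rigid_def)
  ultimately show ?thesis
    using continuous_map_polar_homotopy by (subst homotopic_with) auto
qed

lemma basepoint_rigid: "z \<in> topspace circle \<Longrightarrow> basepoint (rigid z) = z"
  using n \<beta>1 by (simp add: basepoint_def rigid_def circle_def)

lemma homotopy_equivalent_chamber_circle: "chamber n \<beta> homotopy_equivalent_space circle"
  unfolding homotopy_equivalent_space_def
proof (intro exI conjI)
  show "homotopic_with (\<lambda>_. True) (chamber n \<beta>) (chamber n \<beta>) (rigid \<circ> basepoint) id"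
    using rigid_basepoint_homotopic_id homotopic_with_symD by blast
  show "homotopic_with (\<lambda>_. True) circle circle (basepoint \<circ> rigid) id"
    by (rule homotopic_with_id2) (rule basepoint_rigid)
qed (rule continuous_map_basepoint continuous_map_rigid)+

lemma path_connected_space_chamber: "path_connected_space (chamber n \<beta>)"
  using homotopy_equivalent_space_imp_isomorphic_homology_groups[OF homotopy_equivalent_chamber_circle]
    isomorphic_homology_imp_path_connectedness path_connected_space_circle by blast

text \<open>
  The homology of a chamber is that of a circle.
\<close>

lemma cohomology_2_chamber_trivial:
  assumes "A \<in> carrier (cohomology_group 2 (chamber n \<beta>))"
  shows "A = \<one>\<^bsub>cohomology_group 2 (chamber n \<beta>)\<^esub>"
proof -
  note iso = homotopy_equivalent_space_imp_isomorphic_homology_groups[OF homotopy_equivalent_chamber_circle]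
  have H1: "homology_group 1 (chamber n \<beta>) \<cong> integer_group"
    using iso[of 1] homology_group_circle(1) iso_trans by blast
  have H2: "trivial_group (homology_group 2 (chamber n \<beta>))"
    using isomorphic_group_triviality[OF iso[of 2]] homology_group_circle(2) by simp
  obtain \<phi> where \<phi>: "\<phi> \<in> carrier (cocycle_group 2 (chamber n \<beta>))"
    and A: "A = coboundary_set 2 (chamber n \<beta>) #>\<^bsub>cocycle_group 2 (chamber n \<beta>)\<^esub> \<phi>"
    using assms by (rule cohomology_class_obtain)
  show ?thesis
    using two_cocycle_is_coboundary[OF path_connected_space_chamber H1 H2 \<phi>]
      cohomology_class_trivial_iff[OF \<phi>] unfolding A by blast
qed

lemma homotopic_spin_id:
  "homotopic_with (\<lambda>_. True) circle circle id (spin c)"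
proof -
  let ?P = "prod_topology (top_of_set {0..1::real}) circle"
  have t: "continuous_map ?P euclideanreal fst"
    by (rule continuous_map_into_fulltopology[OF continuous_map_fst])
  have z: "continuous_map ?P euclidean snd"
    unfolding circle_def by (rule continuous_map_into_fulltopology[OF continuous_map_snd])
  have "continuous_map ?P euclidean (\<lambda>p. spin (fst p * c) (snd p))"
    using t z unfolding continuous_map_tendsto_iff
    by (intro ballI tendsto_spin tendsto_mult tendsto_const) blast+
  then have "continuous_map ?P circle (\<lambda>p. spin (fst p * c) (snd p))"
    by (auto simp: circle_def continuous_map_in_subtopology)
  then show ?thesis by (subst homotopic_with) auto
qed

text \<open>
  Rotating a configuration as a whole rotates the difference of any two of its points by the same angle.
\<close>

lemma direction_rigid:
  assumes ij: "i \<in> {1..n}" "j \<in> {1..n}" "i \<noteq> j"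
  obtains c where "\<And>z. z \<in> topspace circle \<Longrightarrow> direction i j (rigid z) = spin c z"
proof -
  \<comment> \<open>The chord from the \<open>i\<close>-th to the \<open>j\<close>-th point, for the rotation angle 0;
     it is nonzero since both angles lie in one turn.\<close>
  define w where "w = cis (\<beta> j) - cis (\<beta> i)"
  have "cis (\<beta> j) \<noteq> cis (\<beta> i)"
    using \<beta>[OF ij(1)] \<beta>[OF ij(2)] inj_onD[OF inj _ ij(1,2)] ij(3) Arg2pi_unique[of 1 "\<beta> i"]
      Arg2pi_unique[of 1 "\<beta> j"] by (auto simp: cis_conv_exp)
  then have w0: "w \<noteq> 0" by (simp add: w_def)
  have w: "w = of_real (norm w) * cis (Arg2pi w)"
    using Arg2pi_eq[of w] by (simp add: cis_conv_exp)
  have "direction i j (rigid z) = spin (Arg2pi w) z" if "z \<in> topspace circle" for z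
  proof -
    define d where "d = rigid z j - rigid z i"
    have d: "to_complex d = w * to_complex z"
      using ij by (simp add: d_def rigid_def w_def algebra_simps)
    then have nd: "norm d = norm w"
      using that norm_to_complex[of d] by (simp add: norm_mult circle_def)
    have "to_complex (d /\<^sub>R norm d) = to_complex (spin (Arg2pi w) z)"
      using w0 by (simp add: d nd) (subst w, simp)
    then show ?thesis by (simp only: to_complex_eq_iff direction_def d_def)
  qed
  then show thesis by (rule that)
qed

text \<open>
  This is why only the sum of the coefficients matters: on a chamber all the direction maps are homotopic to
  the same map to the circle. After retraction to the rigid configurations each of them is a rotation, and
  rotations are homotopic to the identity.
\<close>

lemma direction_homotopic_basepoint:
  assumes ij: "(i, j) \<in> index_pairs n"
  shows "homotopic_with (\<lambda>_. True) (chamber n \<beta>) circle (direction i j) basepoint"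
proof -
  let ?h = "homotopic_with (\<lambda>_. True)"
  have ij': "i \<in> {1..n}" "j \<in> {1..n}" "i \<noteq> j" using ij by (auto simp: index_pairs_def)
  have dir: "continuous_map (chamber n \<beta>) circle (direction i j)"
    unfolding chamber_def by (intro continuous_map_from_subtopology continuous_map_direction ij)
  obtain c where c: "\<And>z. z \<in> topspace circle \<Longrightarrow> direction i j (rigid z) = spin c z"
    using direction_rigid[OF ij'] by blast
  have 1: "?h (chamber n \<beta>) circle (direction i j) ((direction i j \<circ> rigid) \<circ> basepoint)"
    using homotopic_with_compose_continuous_map_left[OF rigid_basepoint_homotopic_id dir, where q = "\<lambda>_. True"]
    by (simp add: o_assoc)
  have "?h circle circle (direction i j \<circ> rigid) (spin c)"
    by (rule homotopic_with_equal)
       (simp_all add: c continuous_map_compose[OF continuous_map_rigid dir])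
  then have "?h circle circle (direction i j \<circ> rigid) id"
    using homotopic_with_symD[OF homotopic_spin_id] by (rule homotopic_with_trans)
  then have "?h (chamber n \<beta>) circle ((direction i j \<circ> rigid) \<circ> basepoint) (id \<circ> basepoint)"
    by (rule homotopic_with_compose_continuous_map_right[OF _ continuous_map_basepoint]) simp
  from homotopic_with_trans[OF 1 this] show ?thesis by simp
qed

end

section \<open>Classes that vanish on all chambers\<close>

lemma conf_generator_closed:
  assumes "d\<theta> \<in> carrier (cohomology_group 1 circle)" "p \<in> index_pairs n"
  shows "conf_generator n d\<theta> p \<in> carrier (cohomology_group 1 (Conf n))"
  using assms hom_in_carrier[OF cohomology_map_hom[OF continuous_map_direction]]
  by (cases p) (auto simp: conf_generator_def)

lemma conf_combination_closed:
  assumes "d\<theta> \<in> carrier (cohomology_group 1 circle)"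
  shows "conf_combination n d\<theta> c \<in> carrier (cohomology_group 1 (Conf n))"
proof -
  interpret G: comm_group "cohomology_group 1 (Conf n)" by (rule comm_group_cohomology_group)
  show ?thesis
    unfolding conf_combination_def
    using conf_generator_closed[OF assms] by (intro G.finprod_closed) blast
qed

lemma conf_combination_pullback:
  assumes d\<theta>: "d\<theta> \<in> carrier (cohomology_group 1 circle)"
    and f: "continuous_map X (Conf n) f"
    and a: "a \<in> carrier (cohomology_group 1 X)"
    and same: "\<And>i j. (i, j) \<in> index_pairs n \<Longrightarrow> cohomology_map 1 X (direction i j \<circ> f) d\<theta> = a"
  shows "cohomology_map 1 X f (conf_combination n d\<theta> c) =
      a [^]\<^bsub>cohomology_group 1 X\<^esub> (\<Sum>p\<in>index_pairs n. c p)"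
proof -
  let ?G = "cohomology_group 1 (Conf n)" and ?H = "cohomology_group 1 X"
  let ?F = "cohomology_map 1 X f"
  interpret G: comm_group ?G by (rule comm_group_cohomology_group)
  interpret H: comm_group ?H by (rule comm_group_cohomology_group)
  interpret F: group_hom ?G ?H ?F
    by unfold_locales (rule cohomology_map_hom[OF f])
  note gen = conf_generator_closed[OF d\<theta>]
  have F_gen: "?F (conf_generator n d\<theta> p) = a" if "p \<in> index_pairs n" for p
    using that same cohomology_map_compose[OF f continuous_map_direction d\<theta>]
    by (cases p) (auto simp: conf_generator_def)
  have fin: "finite (index_pairs n)"
    by (rule finite_subset[of _ "{1..n} \<times> {1..n}"]) (auto simp: index_pairs_def)
  have "?F (finprod ?G (\<lambda>p. conf_generator n d\<theta> p [^]\<^bsub>?G\<^esub> c p) S) = a [^]\<^bsub>?H\<^esub> (\<Sum>p\<in>S. c p)"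
    if "finite S" "S \<subseteq> index_pairs n" for S
    using that
  proof (induction S rule: finite_induct)
    case empty
    show ?case unfolding G.finprod_empty F.hom_one by simp
  next
    case (insert p S)
    then have g: "conf_generator n d\<theta> q [^]\<^bsub>?G\<^esub> c q \<in> carrier ?G" if "q \<in> insert p S" for q
      using gen that by blast
    then have gS: "(\<lambda>q. conf_generator n d\<theta> q [^]\<^bsub>?G\<^esub> c q) \<in> S \<rightarrow> carrier ?G" by blast
    have "?F (conf_generator n d\<theta> p [^]\<^bsub>?G\<^esub> c p) = a [^]\<^bsub>?H\<^esub> c p"
      using gen F_gen[of p] F.hom_int_pow insert.prems by simp
    then show ?case
      using insert g gS a by (simp add: G.finprod_insert G.finprod_closed H.int_pow_mult del: One_nat_def)
  qed
  from this[OF fin order_refl] show ?thesis by (simp add: conf_combination_def)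
qed

lemma (in angle_pattern) zero_sum_trivial_on_chamber:
  assumes d\<theta>: "d\<theta> \<in> carrier (cohomology_group 1 circle)" and A: "A \<in> zero_sum_classes n d\<theta>"
  shows "cohomology_map 1 (chamber n \<beta>) id A = \<one>\<^bsub>cohomology_group 1 (chamber n \<beta>)\<^esub>"
proof -
  obtain c where A: "A = conf_combination n d\<theta> c" and c: "(\<Sum>p\<in>index_pairs n. c p) = 0"
    using A by (auto simp: zero_sum_classes_def)
  have id: "continuous_map (chamber n \<beta>) (Conf n) id"
    by (simp add: chamber_def continuous_map_from_subtopology)
  have "cohomology_map 1 (chamber n \<beta>) basepoint d\<theta> \<in> carrier (cohomology_group 1 (chamber n \<beta>))"
    by (rule hom_in_carrier[OF cohomology_map_hom[OF continuous_map_basepoint] d\<theta>])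
  moreover have "cohomology_map 1 (chamber n \<beta>) (direction i j \<circ> id) d\<theta> =
      cohomology_map 1 (chamber n \<beta>) basepoint d\<theta>" if "(i, j) \<in> index_pairs n" for i j
    using homotopic_imp_cohomology_map_eq_degree_1[OF path_connected_space_chamber
        direction_homotopic_basepoint[OF that] d\<theta>] by simp
  ultimately show ?thesis
    unfolding A using conf_combination_pullback[OF d\<theta> id, of _ c] c by simp
qed

definition angular_order :: "nat \<Rightarrow> (nat \<Rightarrow> real ^ 2) \<Rightarrow> (nat \<times> nat) set" where
  "angular_order n x = {(j, k) \<in> {1..n} \<times> {1..n}. angle x j < angle x k}"

text \<open>
  Strict inequalities between angles persist nearby, and since distinct points have distinct angles, the
  inequalities that hold at \<open>x\<close> determine the whole order.
\<close>

lemma openin_angular_order: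
  fixes X :: "(nat \<Rightarrow> real ^ 2) topology"
  assumes cont: "\<And>k. k \<in> {1..n} \<Longrightarrow> continuous_map X euclideanreal (\<lambda>x. angle x k)"
    and inj: "\<And>x. x \<in> topspace X \<Longrightarrow> inj_on (angle x) {1..n}"
  shows "openin X {x \<in> topspace X. angular_order n x = m}"
proof (subst openin_subopen, intro ballI)
  fix x assume "x \<in> {x \<in> topspace X. angular_order n x = m}"
  then have x: "x \<in> topspace X" and m: "angular_order n x = m" by auto
  let ?T = "(\<Inter>(j, k)\<in>angular_order n x. {y \<in> topspace X. angle y j < angle y k}) \<inter> topspace X"
  have "openin X {y \<in> topspace X. angle y j < angle y k}" if "(j, k) \<in> angular_order n x" for j k
  proof -
    have "continuous_map X euclideanreal (\<lambda>y. angle y j - angle y k)"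
      using that by (intro continuous_map_diff cont) (auto simp: angular_order_def)
    from openin_continuous_map_preimage[OF this, of "{..<0}"] show ?thesis by simp
  qed
  moreover have "finite (angular_order n x)"
    by (rule finite_subset[of _ "{1..n} \<times> {1..n}"]) (auto simp: angular_order_def)
  ultimately have "openin X ?T" by (intro openin_INT) auto
  moreover have "x \<in> ?T" using x by (auto simp: angular_order_def)
  moreover have "angular_order n y = m" if y: "y \<in> ?T" for y
  proof -
    have sub: "angular_order n x \<subseteq> angular_order n y" using y by (auto simp: angular_order_def)
    have "(j, k) \<in> angular_order n x" if jk: "(j, k) \<in> angular_order n y" for j k
    proof (rule ccontr)
      assume "(j, k) \<notin> angular_order n x"
      then have "angle x k \<le> angle x j" using jk by (auto simp: angular_order_def)
      moreover have "angle x k \<noteq> angle x j"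
        using inj_onD[OF inj[OF x], of k j] jk by (auto simp: angular_order_def)
      ultimately have "(k, j) \<in> angular_order n x" using jk by (auto simp: angular_order_def)
      then show False using sub jk by (auto simp: angular_order_def)
    qed
    then show ?thesis using sub m by auto
  qed
  then have "?T \<subseteq> {x \<in> topspace X. angular_order n x = m}" by blast
  ultimately show "\<exists>T. openin X T \<and> x \<in> T \<and> T \<subseteq> {x \<in> topspace X. angular_order n x = m}"
    by blast
qed

text \<open>
  The angular order cuts a space of configurations with points on distinct rays into open pieces, and each
  piece lies in the chamber of any of its members.
\<close>

lemma cohomology_trivial_if_trivial_on_chambers:
  assumes n: "1 \<le> n" and A: "A \<in> carrier (cohomology_group (Suc p) (Conf n))"
    and ch: "\<And>\<beta>. angle_pattern n \<beta> \<Longrightarrow>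
      cohomology_map (Suc p) (chamber n \<beta>) id A = \<one>\<^bsub>cohomology_group (Suc p) (chamber n \<beta>)\<^esub>"
    and S: "\<And>x k. \<lbrakk>x \<in> topspace (subtopology (Conf n) S); k \<in> {1..n}\<rbrakk> \<Longrightarrow> x k \<noteq> 0"
      "\<And>x. x \<in> topspace (subtopology (Conf n) S) \<Longrightarrow> inj_on (angle x) {1..n}"
  shows "cohomology_map (Suc p) (subtopology (Conf n) S) id A
    = \<one>\<^bsub>cohomology_group (Suc p) (subtopology (Conf n) S)\<^esub>"
proof (rule cohomology_map_trivial_on_pieces[OF _ A])
  let ?X = "subtopology (Conf n) S"
  let ?l = "angular_order n"
  show "continuous_map ?X (Conf n) id" by (simp add: continuous_map_from_subtopology)
  show "openin ?X {x \<in> topspace ?X. ?l x = m}" for m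
  proof (rule openin_angular_order[OF _ S(2)])
    fix k assume k: "k \<in> {1..n}"
    show "continuous_map ?X euclideanreal (\<lambda>x. angle x k)"
    proof (rule continuous_map_angle)
      fix x assume x: "x \<in> topspace ?X"
      then have x1: "x 1 \<noteq> 0" using S(1) n by simp
      then have "k \<noteq> 1 \<Longrightarrow> angle x k \<noteq> 0"
        using inj_onD[OF S(2)[OF x], of k 1] angle_1[of x, OF x1] k n by auto
      then show "x 1 \<noteq> 0 \<and> x k \<noteq> 0 \<and> (k \<noteq> 1 \<longrightarrow> angle x k \<noteq> 0)"
        using x1 S(1)[OF x k] by blast
    qed (use n k in \<open>auto intro!: continuous_map_from_subtopology continuous_map_coordinate\<close>)
  qed
  fix m assume "m \<in> ?l ` topspace ?X"
  then obtain b where b: "b \<in> topspace ?X" and m: "?l b = m" by blast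
  let ?P = "subtopology ?X {x. ?l x = m}"
  interpret angle_pattern n "angle b"
  proof
    show "angle b 1 = 0" using angle_1[of b] S(1)[OF b] n by simp
  qed (use n S(2)[OF b] angle_bounds in auto)
  have chC: "continuous_map (chamber n (angle b)) (Conf n) id"
    by (simp add: chamber_def continuous_map_from_subtopology)
  have "continuous_map ?P (Conf n) id"
    by (intro continuous_map_from_subtopology) simp
  moreover have "angle x j < angle x k \<longleftrightarrow> angle b j < angle b k"
    if "x \<in> topspace ?P" "j \<in> {1..n}" "k \<in> {1..n}" for x j k
  proof -
    have "?l x = ?l b" using that m by simp
    then have "(j, k) \<in> ?l x \<longleftrightarrow> (j, k) \<in> ?l b" by simp
    then show ?thesis using that by (simp add: angular_order_def)
  qed
  moreover have "x k \<noteq> 0" if "x \<in> topspace ?P" "k \<in> {1..n}" for x k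
    using S(1) that by simp
  ultimately have PC: "continuous_map ?P (chamber n (angle b)) id"
    unfolding chamber_def continuous_map_in_subtopology by auto
  have "cohomology_map (Suc p) ?P id A =
      cohomology_map (Suc p) ?P id (cohomology_map (Suc p) (chamber n (angle b)) id A)"
    using cohomology_map_compose[OF PC chC A] by simp
  also have "\<dots> = \<one>\<^bsub>cohomology_group (Suc p) ?P\<^esub>"
    unfolding ch[OF angle_pattern_axioms]
    by (rule hom_one[OF cohomology_map_hom[OF PC]])
       (simp_all add: comm_group.axioms(2) comm_group_cohomology_group)
  finally show "cohomology_map (Suc p) ?P id A = \<one>\<^bsub>cohomology_group (Suc p) ?P\<^esub>" .
qed

section \<open>Configurations of large disks\<close>

lemma disk_Conf_metric:
  assumes x: "x \<in> topspace (disk_Conf n r)" and r: "r > 0"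
  shows "k \<in> {1..n} \<Longrightarrow> norm (x k) \<le> 1 - r"
    and "\<lbrakk>j \<in> {1..n}; k \<in> {1..n}; j \<noteq> k\<rbrakk> \<Longrightarrow> 2 * r \<le> dist (x j) (x k)"
proof -
  have disj: "disjoint_family_on (\<lambda>i. ball (x i) r) {1..n}"
    and sub: "\<And>k. k \<in> {1..n} \<Longrightarrow> ball (x k) r \<subseteq> cball 0 1"
    using x by (auto simp: disk_Conf_def)
  show "norm (x k) \<le> 1 - r" if "k \<in> {1..n}"
    using sub[OF that] r by (auto simp: ball_subset_cball_iff)
  show "2 * r \<le> dist (x j) (x k)" if "j \<in> {1..n}" "k \<in> {1..n}" "j \<noteq> k"
  proof (rule ccontr)
    assume "\<not> 2 * r \<le> dist (x j) (x k)"
    then have "midpoint (x j) (x k) \<in> ball (x j) r \<inter> ball (x k) r"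
      by (simp add: dist_midpoint)
    then show False using disj that unfolding disjoint_family_on_def by blast
  qed
qed

text \<open>
  The centres have norm at most \<open>1 - r\<close> and mutual distance at least \<open>2 r\<close>, and \<open>2 r > 1 - r\<close> exactly
  when \<open>r > 1 / 3\<close>. A centre at the origin would be within \<open>1 - r\<close> of every other centre, and so would
  two centres on one ray be of each other, since their distance is the difference of their norms.
\<close>

lemma disk_Conf_angles:
  assumes x: "x \<in> topspace (disk_Conf n r)" and r: "r > 1 / 3" and n: "2 \<le> n"
  shows "k \<in> {1..n} \<Longrightarrow> x k \<noteq> 0" and "inj_on (angle x) {1..n}"
proof -
  have "r > 0" using r by simp
  note M = disk_Conf_metric[OF x this]
  show nz: "x k \<noteq> 0" if k: "k \<in> {1..n}" for k
  proof
    assume "x k = 0"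
    obtain j where j: "j \<in> {1..n}" "j \<noteq> k"
      using n that by (metis atLeastAtMost_iff le_trans one_le_numeral order_refl numeral_eq_one_iff semiring_norm(85))
    then show False using M(1)[OF j(1)] M(2)[OF j(1) k j(2)] \<open>x k = 0\<close> r by simp
  qed
  show "inj_on (angle x) {1..n}"
  proof (rule inj_onI, rule ccontr)
    fix j k assume j: "j \<in> {1..n}" and k: "k \<in> {1..n}" and eq: "angle x j = angle x k" and "j \<noteq> k"
    define w where "w = spin (angle x k) (x 1 /\<^sub>R norm (x 1))"
    have x1: "x 1 \<noteq> 0" using nz n by simp
    then have w: "norm w = 1" by (simp add: w_def)
    have "x j = norm (x j) *\<^sub>R w" "x k = norm (x k) *\<^sub>R w"
      using config_polar[of x, OF x1 nz[OF j]] config_polar[of x, OF x1 nz[OF k]] eq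
      by (simp_all only: w_def)
    then have "x j - x k = (norm (x j) - norm (x k)) *\<^sub>R w" by (metis scaleR_left_diff_distrib)
    then have "dist (x j) (x k) = \<bar>norm (x j) - norm (x k)\<bar>" using w by (simp add: dist_norm)
    also have "\<dots> \<le> 1 - r" using M(1)[OF j] M(1)[OF k] by (smt (verit) norm_ge_zero)
    finally show False using M(2)[OF j k \<open>j \<noteq> k\<close>] r by simp
  qed
qed

theorem lemma23:
  fixes r :: real and d\<theta> :: "((real ^ 2) chain \<Rightarrow> int) set"
  assumes "r > 1 / 3"
    and "d\<theta> \<in> carrier (cohomology_group 1 circle)"
    and "generate (cohomology_group 1 circle) {d\<theta>} = carrier (cohomology_group 1 circle)"
  shows "in_degree 2 (Conf 4) ` carrier (cohomology_group 2 (Conf 4))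
           \<union> in_degree 1 (Conf 4) ` zero_sum_classes 4 d\<theta>
         \<subseteq> kernel (total_cohomology (Conf 4)) (total_cohomology (disk_Conf 4 r))
             (total_cohomology_map (disk_Conf 4 r) id)"
proof -
  let ?X = "disk_Conf 4 r"
  have trivial: "cohomology_map (Suc p) ?X id A = \<one>\<^bsub>cohomology_group (Suc p) ?X\<^esub>"
    if A: "A \<in> carrier (cohomology_group (Suc p) (Conf 4))"
      and ch: "\<And>\<beta>. angle_pattern 4 \<beta> \<Longrightarrow>
        cohomology_map (Suc p) (chamber 4 \<beta>) id A = \<one>\<^bsub>cohomology_group (Suc p) (chamber 4 \<beta>)\<^esub>" for p A
    unfolding disk_Conf_def
  proof (rule cohomology_trivial_if_trivial_on_chambers[OF _ A ch], simp)
  qed (use disk_Conf_angles[OF _ \<open>r > 1 / 3\<close>, of _ 4] in \<open>simp_all add: disk_Conf_def\<close>)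
  have kernel: "in_degree p (Conf 4) A \<in> kernel (total_cohomology (Conf 4)) (total_cohomology ?X)
      (total_cohomology_map ?X id)"
    if "A \<in> carrier (cohomology_group p (Conf 4))"
      "cohomology_map p ?X id A = \<one>\<^bsub>cohomology_group p ?X\<^esub>" for p A
  proof -
    have "total_cohomology_map ?X id (in_degree p (Conf 4) A) = \<one>\<^bsub>total_cohomology ?X\<^esub>"
      unfolding total_cohomology_map_in_degree[OF continuous_map_disk_Conf_inclusion] that(2)
      by (simp add: in_degree_def total_cohomology_def fun_eq_iff)
    then show ?thesis using in_degree_closed[OF that(1)] by (simp add: kernel_def)
  qed
  have chC: "continuous_map (chamber 4 \<beta>) (Conf 4) id" for \<beta>
    by (simp add: chamber_def continuous_map_from_subtopology)
  have deg2: "cohomology_map 2 ?X id A = \<one>\<^bsub>cohomology_group 2 ?X\<^esub>"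
    if A: "A \<in> carrier (cohomology_group 2 (Conf 4))" for A
    using trivial[of A 1] A
      angle_pattern.cohomology_2_chamber_trivial[OF _ hom_in_carrier[OF cohomology_map_hom[OF chC] A]]
    by (simp add: numeral_2_eq_2)
  have carr: "A \<in> carrier (cohomology_group 1 (Conf 4))" if "A \<in> zero_sum_classes 4 d\<theta>" for A
    using that conf_combination_closed[OF assms(2)] by (auto simp: zero_sum_classes_def)
  have deg1: "cohomology_map 1 ?X id A = \<one>\<^bsub>cohomology_group 1 ?X\<^esub>"
    if A: "A \<in> zero_sum_classes 4 d\<theta>" for A
    using trivial[of A 0] carr[OF A] angle_pattern.zero_sum_trivial_on_chamber[OF _ assms(2) A] by simp
  show ?thesis using kernel deg1 deg2 carr by blast
qed

end
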